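(* Suppose that Assumptions (A), (B), (C), (D) hold and that $(T_n)_{n\ge1}$ is the regular sequence of designs generated by a density function $f$. If $\lim_{n\to\infty}h=0$ and $\lim_{n\to\infty}nh=\infty$, then for any $x\in\,]0,1[$, $$\mathrm{Var}(\hat g_n^{pro}(x))=\frac{\sigma_{x,h}^2}{m}-\frac1{12mn^2}\int_{x-h}^{x+h}\frac{\alpha(t)}{f^2(t)}\varphi_{x,h}^2(t)\,dt+O\Big(\frac1{mn^3h^2}\Big).$$
   Context: Asymptotics are as $n\to\infty$ with $h=h(n)$, implied constants not depending on $n$ or $m$. Model: $Y_j(t_i)=g(t_i)+\varepsilon_j(t_i)$, $1\le i\le n$, $1\le j\le m$, with $g\in C^2([0,1])$ and $\varepsilon_1,\dots,\varepsilon_m$ i.i.d. copies of a centered second-order process $\varepsilon$ on $[0,1]$ with known continuous autocovariance $R$ such that $(R(s,t))_{s,t\in T}$ is non-singular for every finite $T\subset[0,1]$. $\overline Y(t_i)=\frac1m\sum_jY_j(t_i)$. $K$ is a kernel of class $C^1$ with support $[-1,1]$, $\int_{-1}^1K=1$, $\int_{-1}^1tK(t)dt=0$, $\int_{-1}^1t^2K(t)dt<\infty$; $\varphi_{x,h}(s)=\frac1hK(\frac{x-s}h)$, $h\in(0,1)$. Projection estimator: $f_{x,h}(t)=\int_0^1R(s,t)\varphi_{x,h}(s)ds$, $(m_{x,h}(t_1),\dots,m_{x,h}(t_n))=(f_{x,h}(t_1),\dots,f_{x,h}(t_n))R_{|T_n}^{-1}$ with $R_{|T_n}=(R(t_i,t_j))_{i,j}$,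 and $\hat g_n^{pro}(x)=\sum_{i=1}^nm_{x,h}(t_i)\overline Y(t_i)$. Also $\sigma_{x,h}^2=\int_0^1\int_0^1\varphi_{x,h}(s)R(s,t)\varphi_{x,h}(t)\,ds\,dt$. Regular designs: $T_n=\{t_{i,n}=F^{-1}(i/n),\ i=1,\dots,n\}$, where $F$ is the distribution function of a density $f\in C^2([0,1])$ with $\inf_{0<t<1}f(t)>0$ and $\sup_{0<t<1}f(t)<\infty$. Notation: $R^{(k,l)}$ is the partial derivative of order $k$ in the first and $l$ in the second variable; $R^{(0,1)}(t,t^-)=\lim_{s\uparrow t}\partial R(t,s)/\partial s$, $R^{(0,1)}(t,t^+)=\lim_{s\downarrow t}\partial R(t,s)/\partial s$, similarly for order 2. $\alpha(t)=R^{(0,1)}(t,t^-)-R^{(0,1)}(t,t^+)$ for $t\in]0,1[$. RKHS($R$) is the reproducing kernel Hilbert space with kernel $R$ and norm $\|\cdot\|$. (A) $R$ is continuous on $[0,1]^2$, $R^{(0,1)}(t,t^\pm)$ and $R^{(0,2)}(t,t^\pm)$ exist and are continuous, and off the diagonal $R$ has continuous derivatives up to order two. (B) $\alpha$ is Lipschitz on $]0,1[$, $\inf_{0<t<1}\alpha(t)>0$, $\sup_{0<t<1}\alpha(t)<\infty$. (C) For each $t\in[0,1]$, $R^{(0,2)}(\cdot,t^+)\in$ RKHS($R$) and $\sup_{0\le t\le1}\|R^{(0,2)}(\cdot,t^+)\|<\infty$. (D) $K$ is even and $K'$ is Lipschitz on $[-1,1]$. *)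

theory Defs
  imports
    "HOL-Probability.Probability"
    "Jordan_Normal_Form.Gauss_Jordan_Elimination"
begin

definition C2_on :: "real set \<Rightarrow> (real \<Rightarrow> real) \<Rightarrow> bool" where
  "C2_on S g \<longleftrightarrow>
     (\<exists>g' g''. (\<forall>t\<in>S. (g has_real_derivative g' t) (at t within S)) \<and>
               (\<forall>t\<in>S. (g' has_real_derivative g'' t) (at t within S)) \<and>
               continuous_on S g'')"

text \<open>
  Partial derivatives of a function on the unit square; they are one-sided on its boundary.
  \<^term>\<open>D2 R\<close> is \<open>R\<^sup>(\<^sup>0\<^sup>,\<^sup>1\<^sup>)\<close> and \<^term>\<open>D2 (D2 R)\<close> is \<open>R\<^sup>(\<^sup>0\<^sup>,\<^sup>2\<^sup>)\<close>. The value at a point where the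
  derivative does not exist (typically on the diagonal) is arbitrary and never used.
\<close>

definition D1 :: "(real \<Rightarrow> real \<Rightarrow> real) \<Rightarrow> real \<Rightarrow> real \<Rightarrow> real" where
  "D1 Q s t = vector_derivative (\<lambda>u. Q u t) (at s within {0..1})"

definition D2 :: "(real \<Rightarrow> real \<Rightarrow> real) \<Rightarrow> real \<Rightarrow> real \<Rightarrow> real" where
  "D2 Q s t = vector_derivative (\<lambda>u. Q s u) (at t within {0..1})"

definition offdiag :: "(real \<times> real) set" where
  "offdiag = {(s, t). s \<in> {0..1} \<and> t \<in> {0..1} \<and> s \<noteq> t}"

primrec C_offdiag :: "nat \<Rightarrow> (real \<Rightarrow> real \<Rightarrow> real) \<Rightarrow> bool" where
  "C_offdiag 0 Q \<longleftrightarrow> continuous_on offdiag (\<lambda>(s, t). Q s t)"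
| "C_offdiag (Suc k) Q \<longleftrightarrow>
     continuous_on offdiag (\<lambda>(s, t). Q s t) \<and>
     (\<forall>(s, t)\<in>offdiag. (\<lambda>u. Q u t) differentiable (at s within {0..1}) \<and>
                       (\<lambda>u. Q s u) differentiable (at t within {0..1})) \<and>
     C_offdiag k (D1 Q) \<and> C_offdiag k (D2 Q)"

text \<open>\<open>Q(t, t\<^sup>-)\<close> and \<open>Q(t, t\<^sup>+)\<close>: one-sided limits in the second variable.\<close>

definition diag_left :: "(real \<Rightarrow> real \<Rightarrow> real) \<Rightarrow> real \<Rightarrow> real" where
  "diag_left Q t = Lim (at_left t) (Q t)"

definition diag_right :: "(real \<Rightarrow> real \<Rightarrow> real) \<Rightarrow> real \<Rightarrow> real" where
  "diag_right Q t = Lim (at_right t) (Q t)"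

definition diag_limits_continuous :: "(real \<Rightarrow> real \<Rightarrow> real) \<Rightarrow> bool" where
  "diag_limits_continuous Q \<longleftrightarrow>
     (\<forall>t\<in>{0<..1}. \<exists>l. (Q t \<longlongrightarrow> l) (at_left t)) \<and> continuous_on {0<..1} (diag_left Q) \<and>
     (\<forall>t\<in>{0..<1}. \<exists>l. (Q t \<longlongrightarrow> l) (at_right t)) \<and> continuous_on {0..<1} (diag_right Q)"

definition alpha :: "(real \<Rightarrow> real \<Rightarrow> real) \<Rightarrow> real \<Rightarrow> real" where
  "alpha R t = diag_left (D2 R) t - diag_right (D2 R) t"

text \<open>
  Functions on \<open>X\<close> are represented by their extension by \<open>0\<close>, so that pointwise equality on \<open>X\<close>
  is equality and the vector space operations are the pointwise ones.
\<close>

definition on_set :: "'a set \<Rightarrow> ('a \<Rightarrow> real) \<Rightarrow> 'a \<Rightarrow> real" where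
  "on_set X v = (\<lambda>s. if s \<in> X then v s else 0)"

definition ip_norm :: "(('a \<Rightarrow> real) \<Rightarrow> ('a \<Rightarrow> real) \<Rightarrow> real) \<Rightarrow> ('a \<Rightarrow> real) \<Rightarrow> real" where
  "ip_norm ip v = sqrt (ip v v)"

definition function_hilbert_space ::
  "'a set \<Rightarrow> ('a \<Rightarrow> real) set \<Rightarrow> (('a \<Rightarrow> real) \<Rightarrow> ('a \<Rightarrow> real) \<Rightarrow> real) \<Rightarrow> bool" where
  "function_hilbert_space X H ip \<longleftrightarrow>
     (\<forall>v\<in>H. \<forall>s. s \<notin> X \<longrightarrow> v s = 0) \<and>
     (\<lambda>s. 0) \<in> H \<and>
     (\<forall>u\<in>H. \<forall>v\<in>H. (\<lambda>s. u s + v s) \<in> H) \<and>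
     (\<forall>c. \<forall>v\<in>H. (\<lambda>s. c * v s) \<in> H) \<and>
     (\<forall>u\<in>H. \<forall>v\<in>H. ip u v = ip v u) \<and>
     (\<forall>u\<in>H. \<forall>v\<in>H. \<forall>w\<in>H. ip (\<lambda>s. u s + v s) w = ip u w + ip v w) \<and>
     (\<forall>c. \<forall>u\<in>H. \<forall>v\<in>H. ip (\<lambda>s. c * u s) v = c * ip u v) \<and>
     (\<forall>v\<in>H. 0 \<le> ip v v) \<and>
     (\<forall>v\<in>H. ip v v = 0 \<longrightarrow> v = (\<lambda>s. 0)) \<and>
     (\<forall>u :: nat \<Rightarrow> 'a \<Rightarrow> real.
        (\<forall>i. u i \<in> H) \<and>
        (\<forall>e>0. \<exists>N. \<forall>i\<ge>N. \<forall>j\<ge>N. ip_norm ip (\<lambda>s. u i s - u j s) < e) \<longrightarrow>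
        (\<exists>v\<in>H. (\<lambda>i. ip_norm ip (\<lambda>s. u i s - v s)) \<longlonglongrightarrow> 0))"

definition is_RKHS ::
  "'a set \<Rightarrow> ('a \<Rightarrow> 'a \<Rightarrow> real) \<Rightarrow> ('a \<Rightarrow> real) set \<Rightarrow> (('a \<Rightarrow> real) \<Rightarrow> ('a \<Rightarrow> real) \<Rightarrow> real) \<Rightarrow> bool" where
  "is_RKHS X R H ip \<longleftrightarrow>
     function_hilbert_space X H ip \<and>
     (\<forall>t\<in>X. on_set X (\<lambda>s. R s t) \<in> H \<and> (\<forall>v\<in>H. ip v (on_set X (\<lambda>s. R s t)) = v t))"

text \<open>
  The function \<open>R\<^sup>(\<^sup>0\<^sup>,\<^sup>2\<^sup>)(\<cdot>, t\<^sup>+)\<close>. At \<open>t = 1\<close> there is no limit from the right, and the limit from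
  the left, the only one-sided limit there, is taken instead.
\<close>

definition R02_plus :: "(real \<Rightarrow> real \<Rightarrow> real) \<Rightarrow> real \<Rightarrow> real \<Rightarrow> real" where
  "R02_plus R t = on_set {0..1}
     (\<lambda>s. Lim (if t < 1 then at_right t else at_left t) (\<lambda>u. D2 (D2 R) s u))"

definition assumption_A :: "(real \<Rightarrow> real \<Rightarrow> real) \<Rightarrow> bool" where
  "assumption_A R \<longleftrightarrow>
     continuous_on ({0..1} \<times> {0..1}) (\<lambda>(s, t). R s t) \<and>
     diag_limits_continuous (D2 R) \<and>
     diag_limits_continuous (D2 (D2 R)) \<and>
     C_offdiag 2 R"

definition assumption_B :: "(real \<Rightarrow> real \<Rightarrow> real) \<Rightarrow> bool" where
  "assumption_B R \<longleftrightarrow>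
     (\<exists>L. L-lipschitz_on {0<..<1} (alpha R)) \<and>
     (\<exists>c>0. \<forall>t\<in>{0<..<1}. c \<le> alpha R t) \<and>
     (\<exists>C. \<forall>t\<in>{0<..<1}. alpha R t \<le> C)"

text \<open>The reproducing kernel Hilbert space of \<open>R\<close> is unique, so the quantifier merely names it.\<close>

definition assumption_C :: "(real \<Rightarrow> real \<Rightarrow> real) \<Rightarrow> bool" where
  "assumption_C R \<longleftrightarrow>
     (\<exists>H ip. is_RKHS {0..1} R H ip \<and>
        (\<forall>t\<in>{0..1}. R02_plus R t \<in> H) \<and>
        (\<exists>C. \<forall>t\<in>{0..1}. ip_norm ip (R02_plus R t) \<le> C))"

definition assumption_D :: "(real \<Rightarrow> real) \<Rightarrow> bool" where
  "assumption_D K \<longleftrightarrow>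
     (\<forall>u. K (- u) = K u) \<and> (\<exists>L. L-lipschitz_on {-1..1} (deriv K))"

definition smoothing_kernel :: "(real \<Rightarrow> real) \<Rightarrow> bool" where
  "smoothing_kernel K \<longleftrightarrow>
     K C1_differentiable_on UNIV \<and>
     closure {u. K u \<noteq> 0} = {-1..1} \<and>
     (K has_integral 1) {-1..1} \<and>
     ((\<lambda>t. t * K t) has_integral 0) {-1..1} \<and>
     (\<lambda>t. t\<^sup>2 * K t) integrable_on {-1..1}"

definition design_density :: "(real \<Rightarrow> real) \<Rightarrow> bool" where
  "design_density f \<longleftrightarrow>
     C2_on {0..1} f \<and>
     (\<forall>t\<in>{0..1}. 0 \<le> f t) \<and> (f has_integral 1) {0..1} \<and>
     (\<exists>c>0. \<forall>t\<in>{0<..<1}. c \<le> f t) \<and>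
     (\<exists>C. \<forall>t\<in>{0<..<1}. f t \<le> C)"

definition centered_second_order_process ::
  "'a measure \<Rightarrow> (real \<Rightarrow> 'a \<Rightarrow> real) \<Rightarrow> bool" where
  "centered_second_order_process M e \<longleftrightarrow>
     prob_space M \<and>
     (\<forall>t\<in>{0..1}. e t \<in> borel_measurable M \<and>
                  integrable M (\<lambda>\<omega>. (e t \<omega>)\<^sup>2) \<and>
                  prob_space.expectation M (e t) = 0)"

definition has_autocovariance ::
  "'a measure \<Rightarrow> (real \<Rightarrow> 'a \<Rightarrow> real) \<Rightarrow> (real \<Rightarrow> real \<Rightarrow> real) \<Rightarrow> bool" where
  "has_autocovariance M e R \<longleftrightarrow>
     (\<forall>s\<in>{0..1}. \<forall>t\<in>{0..1}. R s t = prob_space.expectation M (\<lambda>\<omega>. e s \<omega> * e t \<omega>))"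

definition sample_path :: "(real \<Rightarrow> 'a \<Rightarrow> real) \<Rightarrow> 'a \<Rightarrow> real \<Rightarrow> real" where
  "sample_path e \<omega> = (\<lambda>t\<in>{0..1}. e t \<omega>)"

definition iid_copies ::
  "'a measure \<Rightarrow> nat \<Rightarrow> (nat \<Rightarrow> real \<Rightarrow> 'a \<Rightarrow> real) \<Rightarrow> 'b measure \<Rightarrow> (real \<Rightarrow> 'b \<Rightarrow> real) \<Rightarrow> bool" where
  "iid_copies M m eps M0 e \<longleftrightarrow>
     prob_space M \<and>
     prob_space.indep_vars M (\<lambda>_. Pi\<^sub>M {0..1} (\<lambda>_. borel)) (\<lambda>j. sample_path (eps j)) {1..m} \<and>
     (\<forall>j\<in>{1..m}. distr M (Pi\<^sub>M {0..1} (\<lambda>_. borel)) (sample_path (eps j)) =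
                  distr M0 (Pi\<^sub>M {0..1} (\<lambda>_. borel)) (sample_path e))"

definition observation ::
  "(real \<Rightarrow> real) \<Rightarrow> (nat \<Rightarrow> real \<Rightarrow> 'a \<Rightarrow> real) \<Rightarrow> nat \<Rightarrow> real \<Rightarrow> 'a \<Rightarrow> real" where
  "observation g eps j t \<omega> = g t + eps j t \<omega>"

definition mean_observation ::
  "(real \<Rightarrow> real) \<Rightarrow> (nat \<Rightarrow> real \<Rightarrow> 'a \<Rightarrow> real) \<Rightarrow> nat \<Rightarrow> real \<Rightarrow> 'a \<Rightarrow> real" where
  "mean_observation g eps m t \<omega> = (1 / real m) * (\<Sum>j=1..m. observation g eps j t \<omega>)"

definition cov_mat :: "(real \<Rightarrow> real \<Rightarrow> real) \<Rightarrow> real list \<Rightarrow> real mat" where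
  "cov_mat R ts = mat (length ts) (length ts) (\<lambda>(i, j). R (ts ! i) (ts ! j))"

definition nonsingular_kernel :: "(real \<Rightarrow> real \<Rightarrow> real) \<Rightarrow> bool" where
  "nonsingular_kernel R \<longleftrightarrow>
     (\<forall>ts. distinct ts \<and> set ts \<subseteq> {0..1} \<longrightarrow> invertible_mat (cov_mat R ts))"

definition design_point :: "(real \<Rightarrow> real) \<Rightarrow> nat \<Rightarrow> nat \<Rightarrow> real" where
  "design_point f n i = the_inv_into {0..1} (\<lambda>t. integral {0..t} f) (real i / real n)"

definition design :: "(real \<Rightarrow> real) \<Rightarrow> nat \<Rightarrow> real list" where
  "design f n = map (design_point f n) [1..<Suc n]"

definition phi :: "(real \<Rightarrow> real) \<Rightarrow> real \<Rightarrow> real \<Rightarrow> real \<Rightarrow> real" where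
  "phi K x h s = (1 / h) * K ((x - s) / h)"

definition smoothed_cov ::
  "(real \<Rightarrow> real \<Rightarrow> real) \<Rightarrow> (real \<Rightarrow> real) \<Rightarrow> real \<Rightarrow> real \<Rightarrow> real \<Rightarrow> real" where
  "smoothed_cov R K x h t = integral {0..1} (\<lambda>s. R s t * phi K x h s)"

definition sigma_sq ::
  "(real \<Rightarrow> real \<Rightarrow> real) \<Rightarrow> (real \<Rightarrow> real) \<Rightarrow> real \<Rightarrow> real \<Rightarrow> real" where
  "sigma_sq R K x h =
     integral {0..1} (\<lambda>s. integral {0..1} (\<lambda>t. phi K x h s * R s t * phi K x h t))"

text \<open>
  The weights form the row vector \<open>v A\<^sup>-\<^sup>1\<close>, where \<open>v\<close> is the row vector of values of
  \<^const>\<open>smoothed_cov\<close> and \<open>A\<close> the covariance matrix; as a column vector this is \<open>(A\<^sup>-\<^sup>1)\<^sup>T v\<close>.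
\<close>

definition projection_weights ::
  "(real \<Rightarrow> real \<Rightarrow> real) \<Rightarrow> (real \<Rightarrow> real) \<Rightarrow> real \<Rightarrow> real \<Rightarrow> real list \<Rightarrow> real Matrix.vec" where
  "projection_weights R K x h ts =
     transpose_mat (the (mat_inverse (cov_mat R ts))) *\<^sub>v vec_of_list (map (smoothed_cov R K x h) ts)"

definition g_pro ::
  "(real \<Rightarrow> real \<Rightarrow> real) \<Rightarrow> (real \<Rightarrow> real) \<Rightarrow> real \<Rightarrow> real list \<Rightarrow>
   (real \<Rightarrow> real) \<Rightarrow> (nat \<Rightarrow> real \<Rightarrow> 'a \<Rightarrow> real) \<Rightarrow> nat \<Rightarrow> real \<Rightarrow> 'a \<Rightarrow> real" where
  "g_pro R K h ts g eps m x \<omega> =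
     (\<Sum>i<length ts. vec_index (projection_weights R K x h ts) i * mean_observation g eps m (ts ! i) \<omega>)"

end

theory Submission
  imports Defs
begin

text \<open>
  Let \<open>P\<close> be the orthogonal projection of the RKHS of \<open>R\<close> onto the span of the functions
  \<open>R(\<cdot>, t\<^sub>i)\<close>, and put \<open>e = f\<^sub>x\<^sub>,\<^sub>h - P f\<^sub>x\<^sub>,\<^sub>h\<close>. Then \<open>m\<close> times the variance is \<open>\<sigma>\<^sup>2 - V\<close> with
  \<open>V = \<parallel>e\<parallel>\<^sup>2 = \<integral> \<phi> e\<close>. The function \<open>e\<close> vanishes at the design points, and between them
  \<open>e'' = - \<alpha> \<phi> + r\<close>, where \<open>r(t)\<close> is the inner product of \<open>e\<close> with \<open>R\<^sup>(\<^sup>0\<^sup>,\<^sup>2\<^sup>)(\<cdot>, t\<^sup>+)\<close>, so that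
  \<open>\<bar>r\<bar> \<le> C \<surd>V\<close> by assumption (C). On a design interval of length \<open>d\<close> starting at \<open>a\<close>, \<open>e\<close> is
  therefore close to the parabola with second derivative \<open>- \<alpha>(a) \<phi>(a)\<close> vanishing at both ends, and
  \<open>\<integral> \<phi> e\<close> over it is close to \<open>\<alpha>(a) \<phi>(a)\<^sup>2 d\<^sup>3 / 12\<close>. Since \<open>d\<close> is about \<open>1 / (n f(a))\<close>, summing over the
  intervals that meet the support of \<open>\<phi>\<close> (total length at most \<open>4 h\<close>) gives \<open>V\<close> up to
  \<open>O(n\<^sup>-\<^sup>3 h\<^sup>-\<^sup>2) + O(n\<^sup>-\<^sup>2 \<surd>V)\<close>. This already forces \<open>\<surd>V = O(1 / (n h))\<close>, and the second error term is absorbed.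
  For large \<open>n\<close> the interval to the left of the first design point, where \<open>e\<close> is not controlled,
  does not meet the support of \<open>\<phi>\<close>.
\<close>


section \<open>Variance of the projection estimator\<close>

lemma integrable_mult_of_squares:
  fixes f g :: "'a \<Rightarrow> real"
  assumes [measurable]: "f \<in> borel_measurable M" "g \<in> borel_measurable M"
    and "integrable M (\<lambda>x. (f x)\<^sup>2)" "integrable M (\<lambda>x. (g x)\<^sup>2)"
  shows "integrable M (\<lambda>x. f x * g x)"
proof (rule Bochner_Integration.integrable_bound)
  show "integrable M (\<lambda>x. (f x)\<^sup>2 + (g x)\<^sup>2)"
    using assms by auto
  have "\<bar>a * b\<bar> \<le> a\<^sup>2 + b\<^sup>2" for a b :: real
  proof -
    have "0 \<le> \<bar>a\<bar> * \<bar>b\<bar>" by simp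
    then show ?thesis
      using sum_squares_bound[of "\<bar>a\<bar>" "\<bar>b\<bar>"] unfolding abs_mult power2_abs by linarith
  qed
  then show "AE x in M. norm (f x * g x) \<le> norm ((f x)\<^sup>2 + (g x)\<^sup>2)"
    by (intro AE_I2) (auto intro: order_trans[OF _ abs_ge_self])
qed measurable

lemma (in prob_space) variance_sum_uncorrelated:
  fixes Z :: "'i \<Rightarrow> 'a \<Rightarrow> real"
  assumes "finite I"
    and meas: "\<And>j. j \<in> I \<Longrightarrow> random_variable borel (Z j)"
    and sq: "\<And>j. j \<in> I \<Longrightarrow> integrable M (\<lambda>\<omega>. (Z j \<omega>)\<^sup>2)"
    and mean: "\<And>j. j \<in> I \<Longrightarrow> expectation (Z j) = 0"
    and uncorr: "\<And>j k. j \<in> I \<Longrightarrow> k \<in> I \<Longrightarrow> j \<noteq> k \<Longrightarrow> expectation (\<lambda>\<omega>. Z j \<omega> * Z k \<omega>) = 0"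
  shows "variance (\<lambda>\<omega>. c + b * (\<Sum>j\<in>I. Z j \<omega>)) = b\<^sup>2 * (\<Sum>j\<in>I. expectation (\<lambda>\<omega>. (Z j \<omega>)\<^sup>2))"
proof -
  have int: "integrable M (Z j)" if "j \<in> I" for j
    using square_integrable_imp_integrable[of "Z j"] sq[OF that] meas[OF that] by auto
  have int2: "integrable M (\<lambda>\<omega>. Z j \<omega> * Z k \<omega>)" if "j \<in> I" "k \<in> I" for j k
    using that by (intro integrable_mult_of_squares meas sq)
  have "expectation (\<lambda>\<omega>. c + b * (\<Sum>j\<in>I. Z j \<omega>)) = c"
    using int mean by (simp add: prob_space)
  then have "variance (\<lambda>\<omega>. c + b * (\<Sum>j\<in>I. Z j \<omega>)) = expectation (\<lambda>\<omega>. b\<^sup>2 * (\<Sum>j\<in>I. \<Sum>k\<in>I. Z j \<omega> * Z k \<omega>))"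
    by (simp add: power_mult_distrib power2_eq_square[of "sum _ _"] sum_product)
  also have "\<dots> = b\<^sup>2 * (\<Sum>j\<in>I. \<Sum>k\<in>I. expectation (\<lambda>\<omega>. Z j \<omega> * Z k \<omega>))"
    using int2 by (simp add: Bochner_Integration.integral_sum Bochner_Integration.integrable_sum)
  also have "(\<Sum>j\<in>I. \<Sum>k\<in>I. expectation (\<lambda>\<omega>. Z j \<omega> * Z k \<omega>))
      = (\<Sum>j\<in>I. \<Sum>k\<in>I. if k = j then expectation (\<lambda>\<omega>. (Z j \<omega>)\<^sup>2) else 0)"
    using uncorr by (intro sum.cong) (auto simp: power2_eq_square)
  also have "\<dots> = (\<Sum>j\<in>I. expectation (\<lambda>\<omega>. (Z j \<omega>)\<^sup>2))"
    using \<open>finite I\<close> by simp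
  finally show ?thesis .
qed

text \<open>The estimator is a constant plus \<open>1 / m\<close> times the sum of one fixed linear
  functional applied to the \<open>m\<close> noise paths. On a single path the functional has mean 0
  and second moment equal to the quadratic form of \<open>R\<close> in the weights, so independence
  gives \<open>m\<close> times that form, and the factor \<open>1 / m^2\<close> leaves one division
  by \<open>m\<close>.\<close>

lemma variance_g_pro:
  fixes M :: "'a measure" and M0 :: "'b measure" and K :: "real \<Rightarrow> real" and x h :: real
  assumes csp: "centered_second_order_process M0 e"
    and cov: "has_autocovariance M0 e R"
    and iid: "iid_copies M m eps M0 e"
    and m: "m \<ge> 1"
    and ts: "set ts \<subseteq> {0..1}"
  defines "w \<equiv> vec_index (projection_weights R K x h ts)"
  shows "prob_space.variance M (g_pro R K h ts g eps m x)
     = (\<Sum>i<length ts. \<Sum>j<length ts. w i * w j * R (ts ! i) (ts ! j)) / real m"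
proof -
  let ?P = "Pi\<^sub>M {0..1::real} (\<lambda>_. borel :: real measure)"
  define n where "n = length ts"
  define q where "q = (\<Sum>i<n. \<Sum>j<n. w i * w j * R (ts ! i) (ts ! j))"
  interpret M: prob_space M using iid by (simp add: iid_copies_def)
  interpret M0: prob_space M0 using csp by (simp add: centered_second_order_process_def)
  have tsi: "ts ! i \<in> {0..1}" if "i < n" for i
    using ts that nth_mem[of i ts] unfolding n_def by blast
  \<comment> \<open>\<open>L\<close> reads a path at finitely many coordinates, hence is measurable
    for the product sigma-algebra. This lets independence and equality in law of whole paths pass to
    the real variables \<open>Z j\<close>.\<close>
  define L where "L p = (\<Sum>i<n. w i * p (ts ! i))" for p :: "real \<Rightarrow> real"
  have L_meas [measurable]: "L \<in> borel_measurable ?P"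
    unfolding L_def by (intro borel_measurable_sum borel_measurable_times borel_measurable_const
        measurable_component_singleton) (use tsi in auto)
  have L_path: "L (sample_path z \<omega>) = (\<Sum>i<n. w i * z (ts ! i) \<omega>)" for z :: "real \<Rightarrow> 'c \<Rightarrow> real" and \<omega>
    unfolding L_def sample_path_def using tsi by (intro sum.cong) auto
  have e: "e t \<in> borel_measurable M0" "integrable M0 (\<lambda>\<omega>. (e t \<omega>)\<^sup>2)" "M0.expectation (e t) = 0"
    if "t \<in> {0..1}" for t
    using csp that by (auto simp: centered_second_order_process_def)
  have e_path [measurable]: "sample_path e \<in> measurable M0 ?P"
    unfolding sample_path_def by (rule measurable_restrict) (use e in auto)
  have ee: "integrable M0 (\<lambda>\<omega>. e s \<omega> * e t \<omega>)" if "s \<in> {0..1}" "t \<in> {0..1}" for s t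
    using that by (intro integrable_mult_of_squares e)
  have e1: "integrable M0 (e t)" if "t \<in> {0..1}" for t
    using M0.square_integrable_imp_integrable[of "e t"] e[OF that] by auto
  have sqL: "(L (sample_path e \<omega>))\<^sup>2
      = (\<Sum>i<n. \<Sum>j<n. w i * w j * (e (ts ! i) \<omega> * e (ts ! j) \<omega>))" for \<omega>
    unfolding L_path power2_eq_square sum_product by (intro sum.cong) auto
  have L0: "M0.expectation (\<lambda>\<omega>. L (sample_path e \<omega>)) = 0"
    unfolding L_path using e e1 tsi by (subst Bochner_Integration.integral_sum) auto
  have L2_int: "integrable M0 (\<lambda>\<omega>. (L (sample_path e \<omega>))\<^sup>2)"
    unfolding sqL using ee tsi by (intro Bochner_Integration.integrable_sum integrable_mult_right) auto
  have L2: "M0.expectation (\<lambda>\<omega>. (L (sample_path e \<omega>))\<^sup>2) = q"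
  proof -
    have "R (ts ! i) (ts ! j) = M0.expectation (\<lambda>\<omega>. e (ts ! i) \<omega> * e (ts ! j) \<omega>)" if "i < n" "j < n" for i j
      using cov tsi that unfolding has_autocovariance_def by blast
    moreover have int: "integrable M0 (\<lambda>\<omega>. w i * w j * (e (ts ! i) \<omega> * e (ts ! j) \<omega>))" if "i < n" "j < n" for i j
      using ee tsi that by (intro integrable_mult_right) blast
    have "M0.expectation (\<lambda>\<omega>. (L (sample_path e \<omega>))\<^sup>2)
        = (\<Sum>i<n. \<Sum>j<n. M0.expectation (\<lambda>\<omega>. w i * w j * (e (ts ! i) \<omega> * e (ts ! j) \<omega>)))"
      unfolding sqL
      by (subst Bochner_Integration.integral_sum, fastforce intro: int,
          intro sum.cong refl Bochner_Integration.integral_sum, fastforce intro: int)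
    ultimately show ?thesis
      unfolding q_def by simp
  qed
  define Z where "Z j \<omega> = L (sample_path (eps j) \<omega>)" for j \<omega>
  have ind: "M.indep_vars (\<lambda>_. ?P) (\<lambda>j. sample_path (eps j)) {1..m}"
    and dis: "\<And>j. j \<in> {1..m} \<Longrightarrow> distr M ?P (sample_path (eps j)) = distr M0 ?P (sample_path e)"
    using iid by (auto simp: iid_copies_def)
  have eps_path: "sample_path (eps j) \<in> measurable M ?P" if "j \<in> {1..m}" for j
    using ind that unfolding M.indep_vars_def by auto
  have indZ: "M.indep_vars (\<lambda>_. borel) Z {1..m}"
    using M.indep_vars_compose2[OF ind, of "\<lambda>_. L" "\<lambda>_. borel"] by (simp add: Z_def [abs_def])
  have measZ: "Z j \<in> borel_measurable M" if "j \<in> {1..m}" for j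
    unfolding Z_def [abs_def] using measurable_compose[OF eps_path[OF that] L_meas] .
  \<comment> \<open>Both sides are integrals of \<open>G\<close> against the common law of the
    paths.\<close>
  have transfer: "integral\<^sup>L M (\<lambda>\<omega>. G (sample_path (eps j) \<omega>)) = integral\<^sup>L M0 (\<lambda>\<omega>. G (sample_path e \<omega>))"
    "integrable M (\<lambda>\<omega>. G (sample_path (eps j) \<omega>)) = integrable M0 (\<lambda>\<omega>. G (sample_path e \<omega>))"
    if "j \<in> {1..m}" "G \<in> borel_measurable ?P" for j and G :: "(real \<Rightarrow> real) \<Rightarrow> real"
    using integral_distr[OF eps_path[OF that(1)] that(2)] integral_distr[OF e_path that(2)]
      integrable_distr_eq[OF eps_path[OF that(1)] that(2)] integrable_distr_eq[OF e_path that(2)]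
      dis[OF that(1)] by auto
  have Z0: "M.expectation (Z j) = 0" if "j \<in> {1..m}" for j
    using transfer(1)[OF that L_meas] L0 by (simp add: Z_def [abs_def])
  have Z2: "M.expectation (\<lambda>\<omega>. (Z j \<omega>)\<^sup>2) = q" "integrable M (\<lambda>\<omega>. (Z j \<omega>)\<^sup>2)" if "j \<in> {1..m}" for j
    using transfer[OF that, of "\<lambda>p. (L p)\<^sup>2"] L2 L2_int by (auto simp: Z_def)
  have Z1: "integrable M (Z j)" if "j \<in> {1..m}" for j
    using M.square_integrable_imp_integrable[of "Z j"] Z2[OF that] measZ[OF that] by auto
  have uncorr: "M.expectation (\<lambda>\<omega>. Z j \<omega> * Z k \<omega>) = 0" if "j \<in> {1..m}" "k \<in> {1..m}" "j \<noteq> k" for j k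
    using M.indep_vars_lebesgue_integral[of "{j, k}" Z] M.indep_vars_subset[OF indZ, of "{j, k}"]
      that Z0 Z1 by auto
  have "g_pro R K h ts g eps m x \<omega> = (\<Sum>i<n. w i * g (ts ! i)) + 1 / real m * (\<Sum>j\<in>{1..m}. Z j \<omega>)" for \<omega>
  proof -
    have "g_pro R K h ts g eps m x \<omega> = (\<Sum>i<n. w i * (g (ts ! i) + 1 / real m * (\<Sum>j\<in>{1..m}. eps j (ts ! i) \<omega>)))"
      unfolding g_pro_def mean_observation_def observation_def w_def n_def
      using m by (intro sum.cong) (auto simp: sum.distrib field_simps)
    also have "\<dots> = (\<Sum>i<n. w i * g (ts ! i)) + 1 / real m * (\<Sum>i<n. \<Sum>j\<in>{1..m}. w i * eps j (ts ! i) \<omega>)"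
      by (simp add: distrib_left sum.distrib sum_distrib_left mult_ac)
    also have "(\<Sum>i<n. \<Sum>j\<in>{1..m}. w i * eps j (ts ! i) \<omega>) = (\<Sum>j\<in>{1..m}. Z j \<omega>)"
      unfolding Z_def L_path by (rule sum.swap)
    finally show ?thesis .
  qed
  then have "g_pro R K h ts g eps m x = (\<lambda>\<omega>. (\<Sum>i<n. w i * g (ts ! i)) + 1 / real m * (\<Sum>j\<in>{1..m}. Z j \<omega>))"
    by auto
  then have "M.variance (g_pro R K h ts g eps m x) = (1 / real m)\<^sup>2 * (\<Sum>j\<in>{1..m}. M.expectation (\<lambda>\<omega>. (Z j \<omega>)\<^sup>2))"
    using M.variance_sum_uncorrelated[of "{1..m}" Z "\<Sum>i<n. w i * g (ts ! i)" "1 / real m"]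
      measZ Z2(2) Z0 uncorr by simp
  also have "\<dots> = q / real m"
    using Z2 m by (simp add: power2_eq_square)
  finally show ?thesis
    by (simp add: q_def n_def)
qed

text \<open>With \<open>A\<close> the covariance matrix and \<open>B\<close> its inverse, the
  weights are \<open>B^T v\<close>, and \<open>A^T (B^T v) = (B A)^T v = v\<close>; the claim is
  coordinate \<open>j\<close>. These are the normal equations: the projection of the smoothed
  covariance interpolates it at the design points.\<close>

lemma projection_weights_solve:
  assumes "nonsingular_kernel R" "distinct ts" "set ts \<subseteq> {0..1}" "j < length ts"
  shows "(\<Sum>i<length ts. vec_index (projection_weights R K x h ts) i * R (ts ! i) (ts ! j))
       = smoothed_cov R K x h (ts ! j)"
proof -
  define n where "n = length ts"
  define A where "A = cov_mat R ts"
  define v where "v = vec_of_list (map (smoothed_cov R K x h) ts)"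
  have A: "A \<in> carrier_mat n n" by (simp add: A_def cov_mat_def n_def)
  have v: "v \<in> carrier_vec n" by (rule carrier_vecI) (simp add: v_def n_def)
  \<comment> \<open>\<open>invertible_mat\<close> provides an inverse of unspecified size. The size
    follows from the dimensions of the two products, and membership in the units of the matrix ring
    then rules out \<open>mat_inverse A = None\<close>, on which \<open>the\<close> would be
    unspecified.\<close>
  obtain B' where B': "A * B' = 1\<^sub>m n" "B' * A = 1\<^sub>m (dim_row B')"
    using assms A unfolding nonsingular_kernel_def invertible_mat_def inverts_mat_def A_def by auto
  have "B' \<in> carrier_mat n n"
    using B' A by (metis carrier_matD(2) carrier_matI index_mult_mat(2,3) index_one_mat(2,3))
  then have "A \<in> Units (ring_mat TYPE(real) n ())"
    using A B' by (auto simp: Units_def ring_mat_def)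
  then obtain B where "mat_inverse A = Some B"
    using mat_inverse(1)[OF A, where b = "()"] by (cases "mat_inverse A") auto
  then have B: "B * A = 1\<^sub>m n" "B \<in> carrier_mat n n" and pw: "projection_weights R K x h ts = transpose_mat B *\<^sub>v v"
    using mat_inverse(2)[OF A] by (auto simp: projection_weights_def A_def v_def)
  have "transpose_mat A *\<^sub>v (transpose_mat B *\<^sub>v v) = transpose_mat (B * A) *\<^sub>v v"
    using A B v by (subst transpose_mult[of B n n A n]) auto
  then have "vec_index (transpose_mat A *\<^sub>v projection_weights R K x h ts) j = vec_index v j"
    using B v pw by simp
  moreover have "vec_index v j = smoothed_cov R K x h (ts ! j)"
    using assms by (simp add: v_def vec_of_list_index)
  moreover have "vec_index (transpose_mat A *\<^sub>v projection_weights R K x h ts) j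
     = (\<Sum>i<n. vec_index (projection_weights R K x h ts) i * R (ts ! i) (ts ! j))"
    using A B assms pw by (auto simp: scalar_prod_def n_def A_def cov_mat_def atLeast0LessThan mult.commute intro!: sum.cong)
  ultimately show ?thesis by (simp add: n_def)
qed


section \<open>Real analysis\<close>

lemma mvt_real_derivative:
  fixes f f' :: "real \<Rightarrow> real"
  assumes "a < b" "continuous_on {a..b} f"
    and "\<And>t. t \<in> {a<..<b} \<Longrightarrow> (f has_real_derivative f' t) (at t)"
  obtains \<xi> where "\<xi> \<in> {a<..<b}" "f b - f a = f' \<xi> * (b - a)"
proof -
  have "(f has_derivative (*) (f' t)) (at t)" if "a < t" "t < b" for t
    using assms(3)[of t] that by (simp add: has_field_derivative_def)
  from mvt[OF assms(1,2) this] show thesis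
    using that by (metis greaterThanLessThan_iff)
qed

text \<open>By Rolle \<open>w'\<close> has a zero, so the bound on \<open>w''\<close> gives a bound
  \<open>\<delta> * (b - a)\<close> on \<open>w'\<close>; a second mean value step from
  \<open>a\<close>, where \<open>w\<close> vanishes, gives the square. Derivatives are required in
  the open interval only, since the projection error may have kinks at the design points.\<close>

lemma second_order_vanishing_bound:
  fixes w w' w'' :: "real \<Rightarrow> real"
  assumes ab: "a < b" and cont: "continuous_on {a..b} w" and "w a = 0" "w b = 0"
    and d1: "\<And>t. t \<in> {a<..<b} \<Longrightarrow> (w has_real_derivative w' t) (at t)"
    and d2: "\<And>t. t \<in> {a<..<b} \<Longrightarrow> (w' has_real_derivative w'' t) (at t)"
    and bd: "\<And>t. t \<in> {a<..<b} \<Longrightarrow> \<bar>w'' t\<bar> \<le> \<delta>"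
    and t: "t \<in> {a..b}"
  shows "\<bar>w t\<bar> \<le> \<delta> * (b - a)\<^sup>2"
proof -
  have "0 \<le> \<delta>"
    using bd[of "(a + b) / 2"] ab by force
  obtain \<xi> where \<xi>: "\<xi> \<in> {a<..<b}" "w b - w a = w' \<xi> * (b - a)"
    by (rule mvt_real_derivative[OF ab cont d1])
  then have \<xi>0: "w' \<xi> = 0"
    using assms(3,4) ab by simp
  have diff: "\<bar>w' v - w' u\<bar> \<le> \<delta> * (b - a)" if uv: "u \<in> {a<..<b}" "v \<in> {a<..<b}" "u < v" for u v
  proof -
    have "continuous_on {u..v} w'"
      by (rule DERIV_continuous_on[where D = w'']) (use that d2 in \<open>auto intro: has_field_derivative_at_within\<close>)
    then obtain \<eta> where \<eta>: "\<eta> \<in> {u<..<v}" "w' v - w' u = w'' \<eta> * (v - u)"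
      by (rule mvt_real_derivative[OF \<open>u < v\<close>, of w' w'']) (use uv in \<open>auto intro!: d2\<close>)
    then have "\<bar>w' v - w' u\<bar> = \<bar>w'' \<eta>\<bar> * (v - u)"
      using that by (simp add: abs_mult)
    also have "\<dots> \<le> \<delta> * (b - a)"
      using bd[of \<eta>] \<eta> that \<open>0 \<le> \<delta>\<close> by (intro mult_mono) auto
    finally show ?thesis .
  qed
  have w'_bd: "\<bar>w' u\<bar> \<le> \<delta> * (b - a)" if "u \<in> {a<..<b}" for u
    using diff[OF that \<xi>(1)] diff[OF \<xi>(1) that] \<xi>0 \<open>0 \<le> \<delta>\<close> ab
    by (cases u \<xi> rule: linorder_cases) auto
  show ?thesis
  proof (cases "t = a")
    case True
    then show ?thesis using assms(3) \<open>0 \<le> \<delta>\<close> by simp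
  next
    case False
    then have "a < t" using t by auto
    moreover have "continuous_on {a..t} w"
      by (rule continuous_on_subset[OF cont]) (use t in auto)
    ultimately obtain \<eta> where \<eta>: "\<eta> \<in> {a<..<t}" "w t - w a = w' \<eta> * (t - a)"
      by (rule mvt_real_derivative[of a t w w']) (use t in \<open>auto intro!: d1\<close>)
    then have "\<bar>w t\<bar> = \<bar>w' \<eta>\<bar> * (t - a)"
      using assms(3) t by (simp add: abs_mult)
    also have "\<dots> \<le> (\<delta> * (b - a)) * (b - a)"
      using w'_bd[of \<eta>] \<eta> t \<open>0 \<le> \<delta>\<close> by (intro mult_mono) auto
    finally show ?thesis by (simp add: power2_eq_square)
  qed
qed

text \<open>The mean value theorem applies on each side of \<open>s\<close>, and continuity joins
  the two pieces. The case in view is a function of \<open>t\<close> built from \<open>R s\<close>,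
  which may have a kink at \<open>t = s\<close>.\<close>

lemma lipschitz_except_point:
  fixes g g' :: "real \<Rightarrow> real"
  assumes cont: "continuous_on {u..v} g" and uv: "u \<le> v"
    and d: "\<And>t. t \<in> {u<..<v} - {s} \<Longrightarrow> (g has_real_derivative g' t) (at t)"
    and bd: "\<And>t. t \<in> {u<..<v} - {s} \<Longrightarrow> \<bar>g' t\<bar> \<le> L"
  shows "\<bar>g v - g u\<bar> \<le> L * (v - u)"
proof -
  have *: "\<bar>g q - g p\<bar> \<le> L * (q - p)" if "u \<le> p" "p \<le> q" "q \<le> v" "s \<notin> {p<..<q}" for p q
  proof (cases "p = q")
    case False
    then have "p < q" using that by simp
    have "continuous_on {p..q} g"
      by (rule continuous_on_subset[OF cont]) (use that in auto)
    moreover have "(g has_real_derivative g' t) (at t)" if "t \<in> {p<..<q}" for t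
      using d[of t] that \<open>u \<le> p\<close> \<open>q \<le> v\<close> \<open>s \<notin> {p<..<q}\<close> by fastforce
    ultimately obtain \<eta> where \<eta>: "\<eta> \<in> {p<..<q}" "g q - g p = g' \<eta> * (q - p)"
      using mvt_real_derivative[OF \<open>p < q\<close>, of g g'] by metis
    then have "\<bar>g q - g p\<bar> = \<bar>g' \<eta>\<bar> * (q - p)"
      using \<open>p < q\<close> by (simp add: abs_mult)
    also have "\<dots> \<le> L * (q - p)"
      using bd[of \<eta>] \<eta> that by (intro mult_right_mono) fastforce+
    finally show ?thesis .
  qed simp
  show ?thesis
  proof (cases "s \<in> {u<..<v}")
    case True
    then show ?thesis
      using *[of u s] *[of s v] by (auto simp: algebra_simps)
  next
    case False
    then show ?thesis using *[of u v] uv by simp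
  qed
qed

text \<open>Dominated convergence for the difference quotients, which the Lipschitz condition
  dominates by the constant \<open>L\<close>. The exceptional parameter \<open>s = t\<close> is a
  null set, so each \<open>F s\<close> may have a kink at \<open>s\<close> itself, and the value of
  \<open>F'\<close> at \<open>t\<close> is irrelevant.\<close>

lemma has_derivative_integral_lipschitz:
  fixes F :: "real \<Rightarrow> real \<Rightarrow> real" and F' :: "real \<Rightarrow> real"
  assumes t: "t \<in> {a<..<b}"
    and int: "\<And>u. u \<in> {a<..<b} \<Longrightarrow> (\<lambda>s. F s u) integrable_on {p..q}"
    and lip: "\<And>s u v. s \<in> {p..q} \<Longrightarrow> u \<in> {a<..<b} \<Longrightarrow> v \<in> {a<..<b} \<Longrightarrow> \<bar>F s u - F s v\<bar> \<le> L * \<bar>u - v\<bar>"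
    and der: "\<And>s. s \<in> {p..q} - {t} \<Longrightarrow> (F s has_real_derivative F' s) (at t)"
  shows "((\<lambda>u. integral {p..q} (\<lambda>s. F s u)) has_real_derivative integral {p..q} F') (at t)"
    and "F' integrable_on {p..q}"
proof -
  let ?S = "{p..q} - {t}"
  have neg: "negligible {x \<in> {p..q} - ?S. g x \<noteq> 0}" "negligible {x \<in> ?S - {p..q}. g x \<noteq> 0}"
    for g :: "real \<Rightarrow> real"
    by (rule negligible_subset[of "{t}"]; auto)+
  have intS: "g integrable_on ?S \<longleftrightarrow> g integrable_on {p..q}" for g :: "real \<Rightarrow> real"
    using integrable_spike_set[OF _ neg] integrable_spike_set[OF _ neg(2,1)] by blast
  have integralS: "integral ?S g = integral {p..q} g" for g :: "real \<Rightarrow> real"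
    by (rule integral_spike_set[OF neg(2,1)])
  have key: "F' integrable_on ?S \<and> (\<lambda>k. integral ?S (\<lambda>s. (F s (X k) - F s t) / (X k - t))) \<longlonglongrightarrow> integral ?S F'"
    if X: "\<And>k. X k \<in> {a<..<b} - {t}" "X \<longlonglongrightarrow> t" for X :: "nat \<Rightarrow> real"
  proof -
    have i: "(\<lambda>s. (F s (X k) - F s t) / (X k - t)) integrable_on ?S" for k
      unfolding intS using X(1)[of k] t by (intro integrable_on_divide integrable_diff int) auto
    have c: "(\<lambda>s. L) integrable_on ?S" unfolding intS by (rule integrable_const_ivl)
    have bd: "norm ((F s (X k) - F s t) / (X k - t)) \<le> L" if "s \<in> ?S" for k s
    proof -
      have "\<bar>F s (X k) - F s t\<bar> \<le> L * \<bar>X k - t\<bar>"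
        using lip[of s "X k" t] that X(1)[of k] t by auto
      moreover have "X k \<noteq> t" using X(1)[of k] by auto
      ultimately show ?thesis by (simp add: abs_divide divide_le_eq)
    qed
    have lim: "(\<lambda>k. (F s (X k) - F s t) / (X k - t)) \<longlonglongrightarrow> F' s" if "s \<in> ?S" for s
    proof -
      have "((\<lambda>y. (F s y - F s t) / (y - t)) \<longlongrightarrow> F' s) (at t)"
        using der[OF that] unfolding has_field_derivative_iff .
      then have "\<forall>X. (\<forall>i. X i \<in> UNIV - {t}) \<longrightarrow> X \<longlonglongrightarrow> t \<longrightarrow> ((\<lambda>y. (F s y - F s t) / (y - t)) \<circ> X) \<longlonglongrightarrow> F' s"
        unfolding tendsto_at_iff_sequentially .
      then show ?thesis using X by (auto simp: o_def)
    qed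
    show ?thesis
      using dominated_convergence[OF i c bd lim] by auto
  qed
  \<comment> \<open>Integrability of \<open>F'\<close> is itself an output of dominated convergence,
    so one sequence tending to \<open>t\<close> through other points of the interval has to be
    exhibited.\<close>
  obtain X0 :: "nat \<Rightarrow> real" where X0: "\<And>k. X0 k \<in> {a<..<b} - {t}" "X0 \<longlonglongrightarrow> t"
  proof -
    have "t islimpt {a<..<b}" using t by (simp add: interior_limit_point)
    then show thesis using that unfolding islimpt_sequential by auto
  qed
  then show "F' integrable_on {p..q}" using key intS by blast
  have "((\<lambda>y. (integral {p..q} (\<lambda>s. F s y) - integral {p..q} (\<lambda>s. F s t)) / (y - t)) \<longlongrightarrow> integral {p..q} F')
      (at t within {a<..<b})"
    unfolding tendsto_at_iff_sequentially
  proof (intro allI impI)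
    fix X :: "nat \<Rightarrow> real" assume X: "\<forall>i. X i \<in> {a<..<b} - {t}" "X \<longlonglongrightarrow> t"
    have "integral ?S (\<lambda>s. (F s (X k) - F s t) / (X k - t))
        = (integral {p..q} (\<lambda>s. F s (X k)) - integral {p..q} (\<lambda>s. F s t)) / (X k - t)" for k
      unfolding integralS using X t int by (subst integral_divide, subst integral_diff) auto
    then show "((\<lambda>y. (integral {p..q} (\<lambda>s. F s y) - integral {p..q} (\<lambda>s. F s t)) / (y - t)) \<circ> X)
        \<longlonglongrightarrow> integral {p..q} F'"
      using key[of X] X by (simp add: o_def integralS)
  qed
  moreover have "at t within {a<..<b} = at t"
    by (rule at_within_open[OF t]) simp
  ultimately show "((\<lambda>u. integral {p..q} (\<lambda>s. F s u)) has_real_derivative integral {p..q} F') (at t)"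
    unfolding has_field_derivative_iff by simp
qed

section \<open>Partitions and Riemann sums\<close>

lemma integral_partition:
  fixes g :: "real \<Rightarrow> real"
  assumes "\<And>i. i < n \<Longrightarrow> T i \<le> T (Suc i)" "g integrable_on {T 0..T n}"
  shows "integral {T 0..T n} g = (\<Sum>i<n. integral {T i..T (Suc i)} g)"
  using assms
proof (induction n)
  case (Suc n)
  have mono: "T 0 \<le> T k" if "k \<le> Suc n" for k
    using that by (induction k) (use Suc.prems(1) order_trans in \<open>force+\<close>)
  have "g integrable_on {T 0..T n}"
    by (rule integrable_on_subinterval[OF Suc.prems(2)]) (use Suc.prems(1)[of n] in auto)
  then show ?case
    using Suc mono[of n] Henstock_Kurzweil_Integration.integral_combine[of "T 0" "T n" "T (Suc n)" g] by simp
qed simp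

text \<open>Uniform continuity on the square makes the Riemann error small for all \<open>t\<close>
  at once; the iterated double sum below relies on this uniformity.\<close>

lemma riemann_sum_uniform_limit:
  fixes g :: "real \<Rightarrow> real \<Rightarrow> real"
  assumes cont: "continuous_on ({0..1} \<times> {0..1}) (\<lambda>(t, s). g t s)"
  shows "uniform_limit {0..1} (\<lambda>N t. (\<Sum>k<N. g t (real k / real N)) / real N)
    (\<lambda>t. integral {0..1} (g t)) sequentially"
proof (rule uniform_limitI)
  fix \<epsilon> :: real assume "0 < \<epsilon>"
  have "uniformly_continuous_on ({0..1} \<times> {0..1}) (\<lambda>(t, s). g t s)"
    using cont by (intro compact_uniformly_continuous compact_Times) auto
  then obtain \<delta> where "\<delta> > 0" and \<delta>: "\<And>z z'. z \<in> {0..1} \<times> {0..1} \<Longrightarrow> z' \<in> {0..1} \<times> {0..1} \<Longrightarrow>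
      dist z' z < \<delta> \<Longrightarrow> dist (case z' of (t, s) \<Rightarrow> g t s) (case z of (t, s) \<Rightarrow> g t s) < \<epsilon> / 2"
    unfolding uniformly_continuous_on_def using \<open>0 < \<epsilon>\<close> by (metis half_gt_zero)
  obtain N0 :: nat where N0: "1 / \<delta> < real N0" using reals_Archimedean2 by blast
  have "\<forall>t\<in>{0..1}. dist ((\<Sum>k<N. g t (real k / real N)) / real N) (integral {0..1} (g t)) < \<epsilon>"
    if "N \<ge> N0" for N
  proof
    fix t :: real assume t: "t \<in> {0..1}"
    have N: "1 / \<delta> < real N" "0 < N"
    proof -
      show "1 / \<delta> < real N" using N0 that by linarith
      moreover have "0 < 1 / \<delta>" using \<open>\<delta> > 0\<close> by simp
      ultimately have "0 < real N" by linarith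
      then show "0 < N" by simp
    qed
    then have N': "1 / real N < \<delta>" using \<open>\<delta> > 0\<close> by (simp add: field_simps)
    have ct: "continuous_on {0..1} (g t)"
      using continuous_on_compose2[OF cont continuous_on_Pair[OF continuous_on_const continuous_on_id], of t "{0..1}"] t
      by (simp add: image_subset_iff)
    define T where "T k = real k / real N" for k
    have T: "T 0 = 0" "T N = 1" "T k \<le> T (Suc k)" "T (Suc k) - T k = 1 / real N" for k
      using N by (auto simp: T_def field_simps)
    have T01: "T k \<in> {0..1}" if "k \<le> N" for k using that N by (auto simp: T_def)
    have "integral {0..1} (g t) = (\<Sum>k<N. integral {T k..T (Suc k)} (g t))"
      using integral_partition[of N T "g t"] T integrable_continuous_real[OF ct] by simp
    then have "\<bar>(\<Sum>k<N. g t (T k)) / real N - integral {0..1} (g t)\<bar>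
       = \<bar>\<Sum>k<N. (g t (T k) / real N - integral {T k..T (Suc k)} (g t))\<bar>"
      by (simp add: sum_subtractf sum_divide_distrib)
    also have "\<dots> \<le> (\<Sum>k<N. \<bar>g t (T k) / real N - integral {T k..T (Suc k)} (g t)\<bar>)"
      by (rule sum_abs)
    also have "\<dots> \<le> (\<Sum>k<N. \<epsilon> / 2 * (1 / real N))"
    proof (rule sum_mono)
      fix k assume k: "k \<in> {..<N}"
      have sub: "{T k..T (Suc k)} \<subseteq> {0..1}" using T01[of k] T01[of "Suc k"] k by auto
      then have ck: "continuous_on {T k..T (Suc k)} (g t)" by (rule continuous_on_subset[OF ct])
      have "integral {T k..T (Suc k)} (\<lambda>s. g t (T k) - g t s)
          = g t (T k) / real N - integral {T k..T (Suc k)} (g t)"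
        using integrable_continuous_real[OF ck] T(3)[of k] T(4)[of k]
        by (subst integral_diff) (auto simp: mult.commute)
      moreover have "norm (integral {T k..T (Suc k)} (\<lambda>s. g t (T k) - g t s)) \<le> \<epsilon> / 2 * (T (Suc k) - T k)"
      proof (rule integral_bound)
        fix s assume s: "s \<in> {T k..T (Suc k)}"
        then have "dist (t, T k) (t, s) < \<delta>"
          using T(4)[of k] N' by (auto simp: dist_Pair_Pair dist_real_def)
        then show "norm (g t (T k) - g t s) \<le> \<epsilon> / 2"
          using \<delta>[of "(t, s)" "(t, T k)"] s sub t T01[of k] k by (auto simp: dist_real_def)
      qed (use T(3) ck in \<open>auto intro!: continuous_intros\<close>)
      ultimately show "\<bar>g t (T k) / real N - integral {T k..T (Suc k)} (g t)\<bar> \<le> \<epsilon> / 2 * (1 / real N)"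
        using T(4)[of k] by simp
    qed
    also have "\<dots> = \<epsilon> / 2" using N by simp
    finally show "dist ((\<Sum>k<N. g t (real k / real N)) / real N) (integral {0..1} (g t)) < \<epsilon>"
      using \<open>0 < \<epsilon>\<close> by (simp add: dist_real_def T_def)
  qed
  then show "\<forall>\<^sub>F N in sequentially. \<forall>t\<in>{0..1}.
      dist ((\<Sum>k<N. g t (real k / real N)) / real N) (integral {0..1} (g t)) < \<epsilon>"
    unfolding eventually_sequentially by blast
qed

lemma riemann_sum_tendsto:
  fixes g :: "real \<Rightarrow> real"
  assumes "continuous_on {0..1} g"
  shows "(\<lambda>N. (\<Sum>k<N. g (real k / real N)) / real N) \<longlonglongrightarrow> integral {0..1} g"
proof -
  have "continuous_on ({0..1::real} \<times> {0..1}) (\<lambda>(t, s). g s)"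
    unfolding case_prod_unfold
    by (rule continuous_on_compose2[OF assms]) (auto intro!: continuous_intros)
  then have "uniform_limit {0..1::real} (\<lambda>N t. (\<Sum>k<N. g (real k / real N)) / real N)
      (\<lambda>t. integral {0..1} g) sequentially"
    by (rule riemann_sum_uniform_limit)
  from tendsto_uniform_limitI[OF this, of 0] show ?thesis by simp
qed

text \<open>Replacing each inner sum by the integral \<open>G\<close> costs a uniformly small error,
  hence a small average over the outer nodes. What remains is a Riemann sum of the continuous
  function \<open>G\<close>.\<close>

lemma riemann_double_sum_tendsto:
  fixes g :: "real \<Rightarrow> real \<Rightarrow> real"
  assumes cont: "continuous_on ({0..1} \<times> {0..1}) (\<lambda>(t, s). g t s)"
  shows "(\<lambda>N. (\<Sum>k<N. \<Sum>l<N. g (real k / real N) (real l / real N)) / (real N)\<^sup>2)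
    \<longlonglongrightarrow> integral {0..1} (\<lambda>t. integral {0..1} (g t))"
proof -
  define G where "G t = integral {0..1} (g t)" for t
  define S where "S N t = (\<Sum>l<N. g t (real l / real N)) / real N" for N t
  have "continuous_on {0..1} G"
    unfolding G_def using integral_continuous_on_param[of "{0..1}" 0 1 g] cont by simp
  then have "(\<lambda>N. (\<Sum>k<N. G (real k / real N)) / real N) \<longlonglongrightarrow> integral {0..1} G"
    by (rule riemann_sum_tendsto)
  moreover have "(\<lambda>N. (\<Sum>k<N. S N (real k / real N) - G (real k / real N)) / real N) \<longlonglongrightarrow> 0"
  proof (rule LIMSEQ_I)
    fix r :: real assume "0 < r"
    then have "\<forall>\<^sub>F N in sequentially. \<forall>t\<in>{0..1}. dist (S N t) (G t) < r / 2"
      using uniform_limitD[OF riemann_sum_uniform_limit[OF cont], of "r / 2"]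
      by (simp add: S_def G_def)
    then obtain N0 where N0: "\<And>N t. N \<ge> N0 \<Longrightarrow> t \<in> {0..1} \<Longrightarrow> \<bar>S N t - G t\<bar> < r / 2"
      unfolding eventually_sequentially dist_real_def by blast
    have "\<bar>(\<Sum>k<N. S N (real k / real N) - G (real k / real N)) / real N\<bar> < r" if N: "N \<ge> max N0 1" for N
    proof -
      have "\<bar>\<Sum>k<N. S N (real k / real N) - G (real k / real N)\<bar>
          \<le> (\<Sum>k<N. \<bar>S N (real k / real N) - G (real k / real N)\<bar>)"
        by (rule sum_abs)
      also have "\<dots> \<le> (\<Sum>k<N. r / 2)"
        by (intro sum_mono less_imp_le[OF N0]) (use N in auto)
      also have "\<dots> < r * real N" using N \<open>0 < r\<close> by simp
      finally show ?thesis using N by (simp add: abs_divide divide_less_eq)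
    qed
    then show "\<exists>no. \<forall>n\<ge>no. norm ((\<Sum>k<n. S n (real k / real n) - G (real k / real n)) / real n - 0) < r"
      unfolding real_norm_def diff_0_right by blast
  qed
  ultimately have "(\<lambda>N. (\<Sum>k<N. S N (real k / real N)) / real N) \<longlonglongrightarrow> integral {0..1} G"
    using tendsto_add by (fastforce simp: sum_subtractf add_divide_distrib[symmetric])
  moreover have "(\<Sum>k<N. S N (real k / real N)) / real N
      = (\<Sum>k<N. \<Sum>l<N. g (real k / real N) (real l / real N)) / (real N)\<^sup>2" for N
    by (simp add: S_def sum_divide_distrib power2_eq_square)
  ultimately show ?thesis by (simp add: G_def [abs_def])
qed


section \<open>Functionals on a reproducing kernel Hilbert space\<close>

lemma function_hilbert_spaceD:
  assumes "function_hilbert_space X H ip"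
  shows "(\<lambda>s. 0) \<in> H"
    and "u \<in> H \<Longrightarrow> v \<in> H \<Longrightarrow> (\<lambda>s. u s + v s) \<in> H"
    and "v \<in> H \<Longrightarrow> (\<lambda>s. c * v s) \<in> H"
    and "u \<in> H \<Longrightarrow> v \<in> H \<Longrightarrow> ip u v = ip v u"
    and "u \<in> H \<Longrightarrow> v \<in> H \<Longrightarrow> w \<in> H \<Longrightarrow> ip (\<lambda>s. u s + v s) w = ip u w + ip v w"
    and "u \<in> H \<Longrightarrow> v \<in> H \<Longrightarrow> ip (\<lambda>s. c * u s) v = c * ip u v"
    and "v \<in> H \<Longrightarrow> 0 \<le> ip v v"
    and "v \<in> H \<Longrightarrow> ip v v = 0 \<Longrightarrow> v = (\<lambda>s. 0)"
  using assms unfolding function_hilbert_space_def by blast+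

lemma function_hilbert_space_cauchy_schwarz:
  assumes hs: "function_hilbert_space X H ip" and "u \<in> H" "v \<in> H"
  shows "(ip u v)\<^sup>2 \<le> ip u u * ip v v"
proof -
  note addH = function_hilbert_spaceD(2)[OF hs] and scaleH = function_hilbert_spaceD(3)[OF hs]
    and sym = function_hilbert_spaceD(4)[OF hs] and add = function_hilbert_spaceD(5)[OF hs]
    and scale = function_hilbert_spaceD(6)[OF hs] and nonneg = function_hilbert_spaceD(7)[OF hs]
    and zero = function_hilbert_spaceD(8)[OF hs]
  show ?thesis
  proof (cases "ip u u = 0")
    case True
    then have "ip u v = 0"
      using zero[OF \<open>u \<in> H\<close>] scale[OF \<open>u \<in> H\<close> \<open>v \<in> H\<close>, of 0] by simp
    then show ?thesis using True by simp
  next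
    case False
    then have pos: "0 < ip u u" using nonneg[OF \<open>u \<in> H\<close>] by simp
    \<comment> \<open>The minimiser of the quadratic \<open>ip ?z ?z\<close> in \<open>c\<close>;
      nonnegativity of the minimum is the inequality.\<close>
    define c where "c = - ip u v / ip u u"
    let ?z = "\<lambda>s. v s + c * u s"
    have H: "(\<lambda>s. c * u s) \<in> H" "?z \<in> H" using assms(2,3) by (auto intro: addH scaleH)
    have "0 \<le> ip ?z ?z" using H nonneg by blast
    also have "ip ?z ?z = ip v v + 2 * c * ip u v + c\<^sup>2 * ip u u"
    proof -
      have z: "ip ?z w = ip v w + c * ip u w" if "w \<in> H" for w
        using add[OF \<open>v \<in> H\<close> H(1) that] scale[OF \<open>u \<in> H\<close> that] by simp
      show ?thesis
        unfolding z[OF H(2)] sym[OF \<open>v \<in> H\<close> H(2)] sym[OF \<open>u \<in> H\<close> H(2)] z[OF \<open>v \<in> H\<close>] z[OF \<open>u \<in> H\<close>]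
          sym[OF \<open>v \<in> H\<close> \<open>u \<in> H\<close>]
        by (simp add: power2_eq_square algebra_simps)
    qed
    also have "\<dots> = ip v v - (ip u v)\<^sup>2 / ip u u"
      using pos by (simp add: c_def power2_eq_square field_simps)
    finally show ?thesis using pos by (simp add: field_simps)
  qed
qed

text \<open>The functional is represented by the combination \<open>u\<close> of the kernel
  functions at the points \<open>s i\<close>. The reproducing property evaluates
  \<open>ip u v\<close> and, applied to \<open>u\<close> itself, identifies \<open>ip u u\<close>
  with the quadratic form; Cauchy-Schwarz and positivity of \<open>ip\<close> then give the two
  claims.\<close>

lemma RKHS_finite_functional_bound:
  assumes rk: "is_RKHS X R H ip" and fin: "finite I" and s: "\<And>i. i \<in> I \<Longrightarrow> s i \<in> X" and v: "v \<in> H"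
  shows "(\<Sum>i\<in>I. c i * v (s i))\<^sup>2 \<le> ip v v * (\<Sum>i\<in>I. \<Sum>j\<in>I. c i * c j * R (s i) (s j))"
    and "0 \<le> (\<Sum>i\<in>I. \<Sum>j\<in>I. c i * c j * R (s i) (s j))"
proof -
  let ?k = "\<lambda>i. on_set X (\<lambda>y. R y (s i))"
  have hs: "function_hilbert_space X H ip" using rk by (simp add: is_RKHS_def)
  have kH: "?k i \<in> H" and ipk: "\<And>v. v \<in> H \<Longrightarrow> ip v (?k i) = v (s i)" if "i \<in> I" for i
    using rk s[OF that] by (auto simp: is_RKHS_def)
  have "(\<lambda>x. \<Sum>i\<in>I. c i * ?k i x) \<in> H \<and> (\<forall>v\<in>H. ip (\<lambda>x. \<Sum>i\<in>I. c i * ?k i x) v = (\<Sum>i\<in>I. c i * v (s i)))"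
    using fin kH ipk
  proof (induction I)
    case empty
    have "ip (\<lambda>s. 0) v = 0" if "v \<in> H" for v
      using function_hilbert_spaceD(6)[OF hs function_hilbert_spaceD(1)[OF hs] that, of 0] by simp
    then show ?case using function_hilbert_spaceD(1)[OF hs] by simp
  next
    case (insert i I)
    let ?u = "\<lambda>x. \<Sum>i\<in>I. c i * ?k i x"
    have u: "?u \<in> H" "\<And>v. v \<in> H \<Longrightarrow> ip ?u v = (\<Sum>i\<in>I. c i * v (s i))"
      using insert.IH insert.prems by auto
    have ki: "?k i \<in> H" "\<And>v. v \<in> H \<Longrightarrow> ip v (?k i) = v (s i)"
      using insert.prems by auto
    have cH: "(\<lambda>x. c i * ?k i x) \<in> H"
      by (rule function_hilbert_spaceD(3)[OF hs ki(1)])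
    have "(\<lambda>x. c i * ?k i x + ?u x) \<in> H"
      by (rule function_hilbert_spaceD(2)[OF hs cH u(1)])
    moreover have "ip (\<lambda>x. c i * ?k i x + ?u x) v = c i * v (s i) + (\<Sum>i\<in>I. c i * v (s i))" if v: "v \<in> H" for v
    proof -
      have "ip (\<lambda>x. c i * ?k i x + ?u x) v = ip (\<lambda>x. c i * ?k i x) v + ip ?u v"
        by (rule function_hilbert_spaceD(5)[OF hs cH u(1) v])
      also have "ip (\<lambda>x. c i * ?k i x) v = c i * ip (?k i) v"
        by (rule function_hilbert_spaceD(6)[OF hs ki(1) v])
      also have "ip (?k i) v = ip v (?k i)"
        by (rule function_hilbert_spaceD(4)[OF hs ki(1) v])
      finally show ?thesis using ki(2)[OF v] u(2)[OF v] by simp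
    qed
    ultimately show ?case using insert.hyps by simp
  qed
  then obtain u where u: "u = (\<lambda>x. \<Sum>i\<in>I. c i * ?k i x)" "u \<in> H" "\<And>v. v \<in> H \<Longrightarrow> ip u v = (\<Sum>i\<in>I. c i * v (s i))"
    by blast
  have "u (s i) = (\<Sum>j\<in>I. c j * R (s i) (s j))" if "i \<in> I" for i
    using s[OF that] by (simp add: u(1) on_set_def)
  then have uu: "ip u u = (\<Sum>i\<in>I. \<Sum>j\<in>I. c i * c j * R (s i) (s j))"
    using u(3)[OF u(2)] by (simp add: sum_distrib_left mult.assoc)
  show "(\<Sum>i\<in>I. c i * v (s i))\<^sup>2 \<le> ip v v * (\<Sum>i\<in>I. \<Sum>j\<in>I. c i * c j * R (s i) (s j))"
    using function_hilbert_space_cauchy_schwarz[OF hs u(2) v] u(3)[OF v] uu by (simp add: mult.commute)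
  have "0 \<le> ip u u"
    by (rule function_hilbert_spaceD(7)[OF hs u(2)])
  then show "0 \<le> (\<Sum>i\<in>I. \<Sum>j\<in>I. c i * c j * R (s i) (s j))" using uu by simp
qed

text \<open>\<open>v s - v t\<close> is a two-point functional of \<open>v\<close> whose squared
  norm \<open>R s s - R s t - R t s + R t t\<close> tends to 0 as \<open>s\<close> tends to
  \<open>t\<close>, by continuity of \<open>R\<close>.\<close>

lemma RKHS_continuous:
  assumes rk: "is_RKHS {0..1::real} R H ip"
    and cont: "continuous_on ({0..1} \<times> {0..1}) (\<lambda>(s, t). R s t)" and v: "v \<in> H"
  shows "continuous_on {0..1} v"
  unfolding continuous_on_def
proof
  fix t :: real assume t: "t \<in> {0..1}"
  let ?b = "\<lambda>s. sqrt (ip v v * (R s s - R s t - R t s + R t t))"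
  have bd: "\<bar>v s - v t\<bar> \<le> ?b s" if "s \<in> {0..1}" for s
  proof -
    \<comment> \<open>Indexing by booleans keeps the two terms with coefficients 1 and -1 apart even
      when \<open>s = t\<close>.\<close>
    have "(v s - v t)\<^sup>2 \<le> ip v v * (R s s - R s t - R t s + R t t)"
      using RKHS_finite_functional_bound(1)[OF rk, of "{True, False}" "\<lambda>i. if i then s else t" v "\<lambda>i. if i then 1 else -1"]
        that t v by (simp add: algebra_simps)
    then show ?thesis using real_le_rsqrt[of "\<bar>v s - v t\<bar>"] by simp
  qed
  have c1: "((\<lambda>s. R (a s) (b s)) \<longlongrightarrow> R (a t) (b t)) (at t within {0..1})"
    if "continuous_on {0..1} a" "continuous_on {0..1} b" "a ` {0..1} \<subseteq> {0..1}" "b ` {0..1} \<subseteq> {0..1}"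
    for a b :: "real \<Rightarrow> real"
  proof -
    have "continuous_on {0..1} (\<lambda>s. R (a s) (b s))"
      using continuous_on_compose2[OF cont continuous_on_Pair[OF that(1,2)]] that(3,4)
      by (simp add: image_subset_iff)
    then show ?thesis using t unfolding continuous_on_def by blast
  qed
  have "((\<lambda>s. R s s - R s t - R t s + R t t) \<longlongrightarrow> R t t - R t t - R t t + R t t) (at t within {0..1})"
    using t by (intro tendsto_intros c1[of "\<lambda>s. s" "\<lambda>s. s"] c1[of "\<lambda>s. s" "\<lambda>s. t"] c1[of "\<lambda>s. t" "\<lambda>s. s"])
      (auto intro!: continuous_intros)
  then have "(?b \<longlongrightarrow> sqrt (ip v v * (R t t - R t t - R t t + R t t))) (at t within {0..1})"
    by (intro tendsto_real_sqrt tendsto_mult_left)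
  then have "(?b \<longlongrightarrow> 0) (at t within {0..1})" by simp
  then have "((\<lambda>s. v s - v t) \<longlongrightarrow> 0) (at t within {0..1})"
    by (rule Lim_null_comparison[rotated])
      (use bd in \<open>auto simp: eventually_at_filter\<close>)
  then show "(v \<longlongrightarrow> v t) (at t within {0..1})"
    using LIM_zero_iff by blast
qed

text \<open>\<open>V\<close> is the squared norm of the functional that integrates against \<phi>
  and subtracts weighted point values. Riemann sums approximate it by finite functionals, for which
  both bounds hold, and the bounds pass to the limit. No element of \<open>H\<close> representing
  the integral has to be constructed.\<close>

lemma RKHS_integral_functional_bound:
  fixes \<phi> :: "real \<Rightarrow> real" and T w :: "nat \<Rightarrow> real"
  assumes rk: "is_RKHS {0..1} R H ip"
    and cont: "continuous_on ({0..1} \<times> {0..1}) (\<lambda>(s, t). R s t)"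
    and sym: "\<And>s t. s \<in> {0..1} \<Longrightarrow> t \<in> {0..1} \<Longrightarrow> R s t = R t s"
    and \<phi>: "continuous_on {0..1} \<phi>"
    and T: "\<And>j. j < n \<Longrightarrow> T j \<in> {0..1}"
    and v: "v \<in> H"
  defines "V \<equiv> integral {0..1} (\<lambda>s. integral {0..1} (\<lambda>t. \<phi> s * R s t * \<phi> t))
      - 2 * (\<Sum>j<n. w j * integral {0..1} (\<lambda>s. R s (T j) * \<phi> s))
      + (\<Sum>i<n. \<Sum>j<n. w i * w j * R (T i) (T j))"
  shows "(integral {0..1} (\<lambda>s. \<phi> s * v s) - (\<Sum>j<n. w j * v (T j)))\<^sup>2 \<le> ip v v * V"
    and "0 \<le> V"
proof -
  \<comment> \<open>The left summand carries the Riemann nodes \<open>k / N\<close> with weights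
    \<open>\<phi> (k / N) / N\<close>, the right one the points \<open>T j\<close> with weights
    \<open>- w j\<close>. The indices form a disjoint union because a node may coincide with some
    \<open>T j\<close>.\<close>
  let ?I = "\<lambda>N. {..<N} <+> {..<n}"
  define s where "s N = case_sum (\<lambda>k. real k / real N) T" for N :: nat
  define c where "c N = case_sum (\<lambda>k. \<phi> (real k / real N) / real N) (\<lambda>j. - w j)" for N :: nat
  have s01: "s N i \<in> {0..1}" if "i \<in> ?I N" for N i
    using that T by (auto simp: s_def)
  have vc: "continuous_on {0..1} v" by (rule RKHS_continuous[OF rk cont v])
  have "(\<lambda>N. (\<Sum>k<N. \<phi> (real k / real N) * v (real k / real N)) / real N) \<longlonglongrightarrow> integral {0..1} (\<lambda>s. \<phi> s * v s)"
    by (intro riemann_sum_tendsto continuous_intros \<phi> vc)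
  moreover have "(\<Sum>i\<in>?I N. c N i * v (s N i)) = (\<Sum>k<N. \<phi> (real k / real N) * v (real k / real N)) / real N - (\<Sum>j<n. w j * v (T j))" for N
    by (simp add: sum.Plus c_def s_def sum_divide_distrib sum_negf)
  ultimately have lim1: "(\<lambda>N. \<Sum>i\<in>?I N. c N i * v (s N i)) \<longlonglongrightarrow> integral {0..1} (\<lambda>s. \<phi> s * v s) - (\<Sum>j<n. w j * v (T j))"
    by (simp add: tendsto_diff)
  have R1: "continuous_on {0..1} (\<lambda>s. R s t)" if "t \<in> {0..1}" for t
    using continuous_on_compose2[OF cont continuous_on_Pair[OF continuous_on_id continuous_on_const], of t "{0..1}"] that
    by (simp add: image_subset_iff)
  have cc: "continuous_on ({0..1} \<times> {0..1}) (\<lambda>(s, t). \<phi> s * R s t * \<phi> t)"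
  proof -
    have "continuous_on ({0..1::real} \<times> {0..1::real}) (\<lambda>z. \<phi> (fst z))" "continuous_on ({0..1::real} \<times> {0..1::real}) (\<lambda>z. \<phi> (snd z))"
      by (auto intro!: continuous_on_compose2[OF \<phi>] continuous_intros)
    then show ?thesis using cont unfolding case_prod_unfold by (intro continuous_intros)
  qed
  let ?q = "\<lambda>N. (\<Sum>k<N. \<Sum>l<N. \<phi> (real k / real N) * R (real k / real N) (real l / real N) * \<phi> (real l / real N)) / (real N)\<^sup>2"
  let ?l = "\<lambda>N j. (\<Sum>k<N. R (real k / real N) (T j) * \<phi> (real k / real N)) / real N"
  have q: "(\<lambda>N. ?q N) \<longlonglongrightarrow> integral {0..1} (\<lambda>s. integral {0..1} (\<lambda>t. \<phi> s * R s t * \<phi> t))"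
    by (rule riemann_double_sum_tendsto[OF cc])
  have l: "(\<lambda>N. ?l N j) \<longlonglongrightarrow> integral {0..1} (\<lambda>s. R s (T j) * \<phi> s)" if "j < n" for j
    by (intro riemann_sum_tendsto continuous_intros \<phi> R1 T that)
  have "(\<lambda>N. ?q N - 2 * (\<Sum>j<n. w j * ?l N j) + (\<Sum>i<n. \<Sum>j<n. w i * w j * R (T i) (T j))) \<longlonglongrightarrow> V"
    unfolding V_def by (intro tendsto_intros q l) auto
  moreover have "(\<Sum>i\<in>?I N. \<Sum>j\<in>?I N. c N i * c N j * R (s N i) (s N j))
      = ?q N - 2 * (\<Sum>j<n. w j * ?l N j) + (\<Sum>i<n. \<Sum>j<n. w i * w j * R (T i) (T j))" for N
  proof -
    \<comment> \<open>The two mixed blocks agree by symmetry of \<open>R\<close> and together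
      produce the term with factor \<open>- 2\<close>.\<close>
    have "(\<Sum>k<N. \<Sum>j<n. c N (Inl k) * c N (Inr j) * R (s N (Inl k)) (s N (Inr j))) = - (\<Sum>j<n. w j * ?l N j)"
      unfolding sum_distrib_left sum_divide_distrib sum_negf[symmetric] c_def s_def
      by (subst sum.swap) (auto intro!: sum.cong)
    moreover have "(\<Sum>j<n. \<Sum>k<N. c N (Inr j) * c N (Inl k) * R (s N (Inr j)) (s N (Inl k))) = - (\<Sum>j<n. w j * ?l N j)"
      unfolding sum_distrib_left sum_divide_distrib sum_negf[symmetric] c_def s_def
    proof (intro sum.cong refl)
      fix j k assume "j \<in> {..<n}" "k \<in> {..<N}"
      then have "R (T j) (real k / real N) = R (real k / real N) (T j)"
        using T by (intro sym) auto
      then show "case_sum (\<lambda>k. \<phi> (real k / real N) / real N) (\<lambda>j. - w j) (Inr j)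
          * case_sum (\<lambda>k. \<phi> (real k / real N) / real N) (\<lambda>j. - w j) (Inl k)
          * R (case_sum (\<lambda>k. real k / real N) T (Inr j)) (case_sum (\<lambda>k. real k / real N) T (Inl k))
          = - (w j * (R (real k / real N) (T j) * \<phi> (real k / real N) / real N))"
        by simp
    qed
    moreover have "(\<Sum>k<N. \<Sum>l<N. c N (Inl k) * c N (Inl l) * R (s N (Inl k)) (s N (Inl l))) = ?q N"
      unfolding c_def s_def by (simp add: sum_divide_distrib power2_eq_square mult_ac)
    ultimately show ?thesis
      by (simp add: sum.Plus sum.distrib) (simp add: c_def s_def)
  qed
  ultimately have lim2: "(\<lambda>N. \<Sum>i\<in>?I N. \<Sum>j\<in>?I N. c N i * c N j * R (s N i) (s N j)) \<longlonglongrightarrow> V"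
    by simp
  have fin: "finite (?I N)" for N :: nat by simp
  show "(integral {0..1} (\<lambda>s. \<phi> s * v s) - (\<Sum>j<n. w j * v (T j)))\<^sup>2 \<le> ip v v * V"
    by (rule tendsto_le[OF sequentially_bot tendsto_mult[OF tendsto_const lim2] tendsto_power[OF lim1]])
      (intro always_eventually allI RKHS_finite_functional_bound(1)[OF rk fin s01 v])
  show "0 \<le> V"
    by (rule tendsto_lowerbound[OF lim2 always_eventually sequentially_bot])
      (intro allI RKHS_finite_functional_bound(2)[OF rk fin s01 v])
qed


section \<open>Second derivative of the smoothed covariance\<close>

text \<open>\<open>H\<close>, \<open>ip\<close> and \<open>C0\<close> name the witnesses of (C). Of
  (B), the continuity of \<alpha> is recorded here; its bound and Lipschitz constant are carried as
  explicit constants later.\<close>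

locale rkhs_covariance =
  fixes R :: "real \<Rightarrow> real \<Rightarrow> real" and H :: "(real \<Rightarrow> real) set"
    and ip :: "(real \<Rightarrow> real) \<Rightarrow> (real \<Rightarrow> real) \<Rightarrow> real" and C0 :: real
  assumes A: "assumption_A R"
    and alpha_cont: "continuous_on {0<..<1} (alpha R)"
    and sym: "\<And>s t. s \<in> {0..1} \<Longrightarrow> t \<in> {0..1} \<Longrightarrow> R s t = R t s"
    and rk: "is_RKHS {0..1} R H ip"
    and R02_in: "\<And>t. t \<in> {0..1} \<Longrightarrow> R02_plus R t \<in> H"
    and R02_norm: "\<And>t. t \<in> {0..1} \<Longrightarrow> ip_norm ip (R02_plus R t) \<le> C0"
begin

section \<open>Regularity of the kernel off and at the diagonal\<close>

lemma R_cont: "continuous_on ({0..1} \<times> {0..1}) (\<lambda>(s, t). R s t)"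
  using A by (simp add: assumption_A_def)

lemma R_cont_fst: "t \<in> {0..1} \<Longrightarrow> continuous_on {0..1} (\<lambda>s. R s t)"
  using continuous_on_compose2[OF R_cont continuous_on_Pair[OF continuous_on_id continuous_on_const], of t "{0..1}"]
  by (simp add: image_subset_iff)

lemma R_cont_snd: "s \<in> {0..1} \<Longrightarrow> continuous_on {0..1} (R s)"
  using continuous_on_compose2[OF R_cont continuous_on_Pair[OF continuous_on_const continuous_on_id], of s "{0..1}"]
  by (simp add: image_subset_iff)

lemma has_derivative_D2:
  assumes "s \<in> {0..1}" "t \<in> {0<..<1}" "s \<noteq> t"
  shows "(R s has_real_derivative D2 R s t) (at t)"
    and "(D2 R s has_real_derivative D2 (D2 R) s t) (at t)"
proof -
  have off: "(s, t) \<in> offdiag" using assms by (auto simp: offdiag_def)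
  have at: "at t within {0..1} = at t" using assms by (intro at_within_Icc_at) auto
  have "(\<lambda>u. R s u) differentiable (at t within {0..1})" "(\<lambda>u. D2 R s u) differentiable (at t within {0..1})"
    using A off unfolding assumption_A_def by (auto simp: numeral_2_eq_2)
  then show "(R s has_real_derivative D2 R s t) (at t)"
    and "(D2 R s has_real_derivative D2 (D2 R) s t) (at t)"
    unfolding at D2_def vector_derivative_works has_real_derivative_iff_has_vector_derivative by simp_all
qed

text \<open>Off the diagonal the second derivative is continuous, so its right limit is its value.
  Membership of \<open>R02_plus R t\<close> in the RKHS thereby gives information on
  \<open>D2 (D2 R)\<close> away from \<open>s = t\<close>.\<close>

lemma R02_plus_eq:
  assumes "s \<in> {0..1}" "t \<in> {0<..<1}" "s \<noteq> t"
  shows "R02_plus R t s = D2 (D2 R) s t"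
proof -
  have "continuous_on offdiag (\<lambda>(s, t). D2 (D2 R) s t)"
    using A unfolding assumption_A_def by (auto simp: numeral_2_eq_2)
  from continuous_on_compose2[OF this continuous_on_Pair[OF continuous_on_const continuous_on_id], of s "{0<..<1} - {s}"]
  have "continuous_on ({0<..<1} - {s}) (D2 (D2 R) s)"
    using assms by (simp add: image_subset_iff offdiag_def)
  moreover have "open ({0<..<1} - {s})" by (simp add: open_delete)
  ultimately have "isCont (D2 (D2 R) s) t"
    using assms by (auto simp: continuous_on_eq_continuous_at)
  then have "(D2 (D2 R) s \<longlongrightarrow> D2 (D2 R) s t) (at_right t)"
    unfolding isCont_def by (rule tendsto_within_subset) simp
  then have "Lim (at_right t) (D2 (D2 R) s) = D2 (D2 R) s t"
    by (intro tendsto_Lim) simp_all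
  then show ?thesis using assms by (simp add: R02_plus_def on_set_def)
qed

text \<open>A member \<open>v\<close> of the RKHS satisfies
  \<open>(v s)^2 \<le> ip v v * R s s\<close>. With \<open>v = R02_plus R t\<close>, the uniform
  norm bound of (C) gives a pointwise bound that holds right up to the diagonal.\<close>

lemma D2_D2_bounded:
  obtains B where "0 \<le> B" "\<And>s t. s \<in> {0..1} \<Longrightarrow> t \<in> {0<..<1} \<Longrightarrow> s \<noteq> t \<Longrightarrow> \<bar>D2 (D2 R) s t\<bar> \<le> B"
proof -
  have "continuous_on {0..1} (\<lambda>s. R s s)"
    using continuous_on_compose2[OF R_cont continuous_on_Pair[OF continuous_on_id continuous_on_id], of "{0..1}"]
    by (simp add: image_subset_iff)
  then have "bounded ((\<lambda>s. R s s) ` {0..1})"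
    by (intro compact_imp_bounded compact_continuous_image) auto
  then obtain m where m: "\<forall>s\<in>{0..1}. \<bar>R s s\<bar> \<le> m"
    unfolding bounded_iff by auto
  have hs: "function_hilbert_space {0..1} H ip" using rk by (simp add: is_RKHS_def)
  have "\<bar>D2 (D2 R) s t\<bar> \<le> \<bar>C0\<bar> * sqrt \<bar>m\<bar>" if st: "s \<in> {0..1}" "t \<in> {0<..<1}" "s \<noteq> t" for s t
  proof -
    let ?v = "R02_plus R t"
    have t: "t \<in> {0..1}" using st by auto
    have nn: "0 \<le> ip ?v ?v" by (rule function_hilbert_spaceD(7)[OF hs R02_in[OF t]])
    have "(?v s)\<^sup>2 \<le> ip ?v ?v * R s s"
      using RKHS_finite_functional_bound(1)[OF rk, of "{()}" "\<lambda>_. s" ?v "\<lambda>_. 1"] R02_in[OF t] st by simp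
    also have "\<dots> \<le> ip ?v ?v * \<bar>m\<bar>"
      using bspec[OF m st(1)] by (intro mult_left_mono nn) linarith
    finally have "\<bar>?v s\<bar> \<le> sqrt (ip ?v ?v * \<bar>m\<bar>)"
      using real_le_rsqrt[of "\<bar>?v s\<bar>"] by simp
    also have "\<dots> = ip_norm ip ?v * sqrt \<bar>m\<bar>" by (simp add: ip_norm_def real_sqrt_mult)
    also have "\<dots> \<le> \<bar>C0\<bar> * sqrt \<bar>m\<bar>"
      using R02_norm[OF t] by (intro mult_right_mono) auto
    finally show ?thesis using R02_plus_eq[OF st] by simp
  qed
  then show thesis by (intro that[of "\<bar>C0\<bar> * sqrt \<bar>m\<bar>"]) auto
qed

lemma C0_nonneg: "0 \<le> C0"
proof -
  have "0 \<le> ip_norm ip (R02_plus R 0)"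
    using function_hilbert_spaceD(7)[of "{0..1}" H ip "R02_plus R 0"] R02_in[of 0] rk
    by (simp add: is_RKHS_def ip_norm_def)
  also have "\<dots> \<le> C0" by (rule R02_norm) simp
  finally show ?thesis .
qed

lemma diag_limits:
  assumes "s \<in> {0<..<1}"
  shows "(D2 R s \<longlongrightarrow> diag_left (D2 R) s) (at_left s)"
    and "(D2 R s \<longlongrightarrow> diag_left (D2 R) s - alpha R s) (at_right s)"
proof -
  have "diag_limits_continuous (D2 R)" using A by (simp add: assumption_A_def)
  then obtain l r where lr: "(D2 R s \<longlongrightarrow> l) (at_left s)" "(D2 R s \<longlongrightarrow> r) (at_right s)"
    unfolding diag_limits_continuous_def using assms by (metis greaterThanAtMost_iff atLeastLessThan_iff greaterThanLessThan_iff less_imp_le)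
  then have "diag_left (D2 R) s = l" "diag_right (D2 R) s = r"
    unfolding diag_left_def diag_right_def by (auto intro!: tendsto_Lim)
  then show "(D2 R s \<longlongrightarrow> diag_left (D2 R) s) (at_left s)"
    and "(D2 R s \<longlongrightarrow> diag_left (D2 R) s - alpha R s) (at_right s)"
    using lr by (auto simp: alpha_def)
qed

lemma diag_left_cont: "continuous_on {0<..<1} (diag_left (D2 R))"
proof -
  have "diag_limits_continuous (D2 R)" using A by (simp add: assumption_A_def)
  then have "continuous_on {0<..1} (diag_left (D2 R))" by (simp add: diag_limits_continuous_def)
  then show ?thesis by (rule continuous_on_subset) auto
qed

text \<open>
  Adding \<open>\<alpha>(s) (t - s)\<^sup>+\<close> removes the kink of \<open>R(s, \<cdot>)\<close> at \<open>s\<close>, and the sum can be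
  differentiated twice under the integral sign by dominated convergence; the added term contributes
  the integral of \<open>\<alpha> \<phi>\<close> up to \<open>t\<close> to the first derivative.
\<close>

lemma integral_second_derivative:
  fixes \<phi> :: "real \<Rightarrow> real"
  assumes cd: "0 < c" "c < d" "d < 1" and \<phi>: "continuous_on {c..d} \<phi>"
  obtains f' where
    "\<And>t. t \<in> {c<..<d} \<Longrightarrow> ((\<lambda>t. integral {c..d} (\<lambda>s. R s t * \<phi> s)) has_real_derivative f' t) (at t)"
    "\<And>t. t \<in> {c<..<d} \<Longrightarrow>
       (f' has_real_derivative integral {c..d} (\<lambda>s. D2 (D2 R) s t * \<phi> s) - alpha R t * \<phi> t) (at t)"
proof -
  let ?\<alpha> = "alpha R" and ?l = "diag_left (D2 R)"
  \<comment> \<open>\<open>S s\<close> is the derivative of \<open>Q s\<close> off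
    \<open>t = s\<close>. The value \<open>?l s\<close> at \<open>t = s\<close> makes it continuous:
    the left limit of \<open>D2 R s\<close> is \<open>?l s\<close>, and the right limit
    \<open>?l s - ?\<alpha> s\<close> is raised by \<open>?\<alpha> s\<close>.\<close>
  define S where "S s t = (if t = s then ?l s else D2 R s t + (if s < t then ?\<alpha> s else 0))" for s t
  define Q where "Q s t = R s t + ?\<alpha> s * max 0 (t - s)" for s t
  have sub: "{c..d} \<subseteq> {0<..<1}" using cd by auto
  have \<alpha>c: "continuous_on {c..d} ?\<alpha>" by (rule continuous_on_subset[OF alpha_cont sub])
  have lc: "continuous_on {c..d} ?l" by (rule continuous_on_subset[OF diag_left_cont sub])
  obtain B where B: "0 \<le> B" "\<And>s t. s \<in> {0..1} \<Longrightarrow> t \<in> {0<..<1} \<Longrightarrow> s \<noteq> t \<Longrightarrow> \<bar>D2 (D2 R) s t\<bar> \<le> B"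
    using D2_D2_bounded by blast
  have bdd: "\<exists>m. \<forall>s\<in>{c..d}. \<bar>g s\<bar> \<le> m" if "continuous_on {c..d} g" for g :: "real \<Rightarrow> real"
    using compact_imp_bounded[OF compact_continuous_image[OF that]] unfolding bounded_iff by auto
  obtain P where P: "\<And>s. s \<in> {c..d} \<Longrightarrow> \<bar>?l s\<bar> \<le> P" using bdd[OF lc] by blast
  obtain M where M: "\<And>s. s \<in> {c..d} \<Longrightarrow> \<bar>\<phi> s\<bar> \<le> M" using bdd[OF \<phi>] by blast
  obtain b where b: "\<And>s. s \<in> {c..d} \<Longrightarrow> \<bar>?\<alpha> s * \<phi> s\<bar> \<le> b"
    using bdd[OF continuous_on_mult[OF \<alpha>c \<phi>]] by blast
  have S_near: "\<forall>\<^sub>F u in nhds t. S s u = D2 R s u + (if s < t then ?\<alpha> s else 0)" if "t \<noteq> s" for s t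
  proof (cases "s < t")
    case True
    then have "\<forall>\<^sub>F u in nhds t. u \<in> {s<..}" by (intro eventually_nhds_in_open) auto
    then show ?thesis by eventually_elim (use True in \<open>auto simp: S_def\<close>)
  next
    case False
    then have "\<forall>\<^sub>F u in nhds t. u \<in> {..<s}" using that by (intro eventually_nhds_in_open) auto
    then show ?thesis by eventually_elim (use False in \<open>auto simp: S_def\<close>)
  qed
  have m_near: "((\<lambda>u. max 0 (u - s)) has_real_derivative (if s < t then 1 else 0)) (at t)" if "t \<noteq> s" for s t :: real
  proof (cases "s < t")
    case True
    then have "\<forall>\<^sub>F u in nhds t. u \<in> {s<..}" by (intro eventually_nhds_in_open) auto
    then have "\<forall>\<^sub>F u in nhds t. max 0 (u - s) = u - s" by eventually_elim auto
    moreover have "((\<lambda>u. u - s) has_real_derivative 1) (at t)" by (auto intro!: derivative_eq_intros)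
    ultimately show ?thesis using True DERIV_cong_ev[of t t "\<lambda>u. max 0 (u - s)" "\<lambda>u. u - s" 1 1] by simp
  next
    case False
    then have "\<forall>\<^sub>F u in nhds t. u \<in> {..<s}" using that by (intro eventually_nhds_in_open) auto
    then have "\<forall>\<^sub>F u in nhds t. max 0 (u - s) = 0" by eventually_elim auto
    moreover have "((\<lambda>u. 0) has_real_derivative 0) (at t)" by simp
    ultimately show ?thesis using False DERIV_cong_ev[of t t "\<lambda>u. max 0 (u - s)" "\<lambda>u. 0" 0 0] by simp
  qed
  have S_der: "(S s has_real_derivative D2 (D2 R) s t) (at t)"
    if "s \<in> {c..d}" "t \<in> {0<..<1}" "t \<noteq> s" for s t
  proof -
    have "((\<lambda>u. D2 R s u + (if s < t then ?\<alpha> s else 0)) has_real_derivative D2 (D2 R) s t) (at t)"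
      using has_derivative_D2(2)[of s t] that cd by (auto intro!: derivative_eq_intros)
    then show ?thesis using DERIV_cong_ev[OF refl S_near[OF that(3)] refl] by blast
  qed
  have Q_der: "(Q s has_real_derivative S s t) (at t)" if "s \<in> {c..d}" "t \<in> {0<..<1}" "t \<noteq> s" for s t
    unfolding Q_def [abs_def]
    using has_derivative_D2(1)[of s t] m_near[OF that(3)] that cd
    by (auto intro!: derivative_eq_intros simp: S_def)
  have S_cont: "continuous_on {0<..<1} (S s)" if s: "s \<in> {c..d}" for s
  proof -
    have "isCont (S s) t" if t: "t \<in> {0<..<1}" for t
    proof (cases "t = s")
      case False
      then show ?thesis using S_der[OF s t] DERIV_isCont by blast
    next
      case True
      have s01: "s \<in> {0<..<1}" using s sub by auto
      have "(S s \<longlongrightarrow> ?l s) (at_left s)"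
      proof (rule Lim_transform_eventually[OF diag_limits(1)[OF s01]])
        show "\<forall>\<^sub>F u in at_left s. D2 R s u = S s u"
          by (auto simp: eventually_at_filter S_def)
      qed
      moreover have "(S s \<longlongrightarrow> ?l s) (at_right s)"
      proof (rule Lim_transform_eventually)
        show "((\<lambda>u. D2 R s u + ?\<alpha> s) \<longlongrightarrow> ?l s) (at_right s)"
          using tendsto_add[OF diag_limits(2)[OF s01] tendsto_const[of "?\<alpha> s"]] by simp
        show "\<forall>\<^sub>F u in at_right s. D2 R s u + ?\<alpha> s = S s u"
          by (auto simp: eventually_at_filter S_def)
      qed
      ultimately have "(S s \<longlongrightarrow> ?l s) (at s)" by (rule filterlim_split_at)
      then show ?thesis unfolding True isCont_def by (simp add: S_def)
    qed
    then show ?thesis by (simp add: continuous_at_imp_continuous_on)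
  qed
  \<comment> \<open>Off \<open>s\<close> the derivative of \<open>S s\<close> is the bounded second
    derivative of \<open>R s\<close>, and \<open>S s\<close> is continuous across
    \<open>s\<close>.\<close>
  have S_lip: "\<bar>S s v - S s u\<bar> \<le> B * \<bar>v - u\<bar>"
    if s: "s \<in> {c..d}" and u: "u \<in> {0<..<1}" and v: "v \<in> {0<..<1}" for s u v
  proof -
    have *: "\<bar>S s v - S s u\<bar> \<le> B * (v - u)" if "u \<in> {0<..<1}" "v \<in> {0<..<1}" "u \<le> v" for u v
      by (rule lipschitz_except_point[where s = s and g' = "\<lambda>t. D2 (D2 R) s t"])
        (use that s sub in \<open>auto intro!: S_der B(2) continuous_on_subset[OF S_cont]\<close>)
    show ?thesis using *[of u v] *[of v u] u v by (cases "u \<le> v") (auto simp: abs_minus_commute)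
  qed
  \<comment> \<open>\<open>S s\<close> starts from \<open>?l s\<close> at \<open>s\<close> and moves
    by at most \<open>B\<close> within the unit interval.\<close>
  have S_bd: "\<bar>S s t\<bar> \<le> P + B" if s: "s \<in> {c..d}" and t: "t \<in> {0<..<1}" for s t
  proof -
    have "\<bar>S s t - S s s\<bar> \<le> B * \<bar>t - s\<bar>" using S_lip[of s s t] s t sub by auto
    also have "\<dots> \<le> B * 1" using B(1) s t cd by (intro mult_left_mono) auto
    finally show ?thesis using P[OF s] by (simp add: S_def split: if_splits)
  qed
  have Q_lip: "\<bar>Q s v - Q s u\<bar> \<le> (P + B) * \<bar>v - u\<bar>"
    if s: "s \<in> {c..d}" and u: "u \<in> {0<..<1}" and v: "v \<in> {0<..<1}" for s u v
  proof -
    have Qc: "continuous_on {0..1} (Q s)"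
      unfolding Q_def [abs_def] using s cd by (intro continuous_intros R_cont_snd) auto
    have *: "\<bar>Q s v - Q s u\<bar> \<le> (P + B) * (v - u)" if "u \<in> {0<..<1}" "v \<in> {0<..<1}" "u \<le> v" for u v
      by (rule lipschitz_except_point[where s = s and g' = "\<lambda>t. S s t"])
        (use that s sub in \<open>auto intro!: Q_der S_bd continuous_on_subset[OF Qc]\<close>)
    show ?thesis using *[of u v] *[of v u] u v by (cases "u \<le> v") (auto simp: abs_minus_commute)
  qed
  have sub': "u \<in> {0<..<1}" if "u \<in> {c<..<d}" for u using that cd by auto
  have R\<phi>: "continuous_on {c..d} (\<lambda>s. R s u * \<phi> s)" if "u \<in> {c<..<d}" for u
    using that cd by (intro continuous_intros \<phi> continuous_on_subset[OF R_cont_fst]) auto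
  have A\<phi>: "continuous_on {c..d} (\<lambda>s. ?\<alpha> s * \<phi> s * max 0 (u - s))" for u
    by (intro continuous_intros \<phi> \<alpha>c)
  have scale: "\<bar>a * \<phi> s - a' * \<phi> s\<bar> \<le> (L * M) * r" if "\<bar>a - a'\<bar> \<le> L * r" "s \<in> {c..d}" for a a' L r s
  proof -
    have "\<bar>a * \<phi> s - a' * \<phi> s\<bar> = \<bar>a - a'\<bar> * \<bar>\<phi> s\<bar>"
      by (simp add: left_diff_distrib[symmetric] abs_mult)
    also have "\<dots> \<le> (L * r) * M" using that M[of s] by (intro mult_mono) auto
    finally show ?thesis by (simp add: mult_ac)
  qed
  have Q_int: "(\<lambda>s. Q s u * \<phi> s) integrable_on {c..d}" if "u \<in> {c<..<d}" for u
    using integrable_add[OF integrable_continuous_real[OF R\<phi>[OF that]] integrable_continuous_real[OF A\<phi>[of u]]]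
    by (simp add: Q_def algebra_simps)
  have D1: "((\<lambda>u. integral {c..d} (\<lambda>s. Q s u * \<phi> s)) has_real_derivative integral {c..d} (\<lambda>s. S s t * \<phi> s)) (at t)"
    "(\<lambda>s. S s t * \<phi> s) integrable_on {c..d}" if t: "t \<in> {c<..<d}" for t
    by (rule has_derivative_integral_lipschitz[OF t Q_int, where L = "(P + B) * M"];
        use t sub' in \<open>auto intro!: scale Q_lip DERIV_cmult_right Q_der\<close>)+
  have D2: "((\<lambda>u. integral {c..d} (\<lambda>s. S s u * \<phi> s)) has_real_derivative integral {c..d} (\<lambda>s. D2 (D2 R) s t * \<phi> s)) (at t)"
    if t: "t \<in> {c<..<d}" for t
    by (rule has_derivative_integral_lipschitz(1)[OF t D1(2), where L = "B * M"];
        use t sub' in \<open>auto intro!: scale S_lip DERIV_cmult_right S_der\<close>)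
  \<comment> \<open>In \<open>u\<close>, \<open>max 0 (u - s)\<close> is 1-Lipschitz, with
    derivative at \<open>t\<close> equal to 1 for \<open>s < t\<close> and 0 for
    \<open>s > t\<close>. The compensating term therefore differentiates to an integral up to
    \<open>t\<close>, whose own derivative in \<open>A2\<close> is the source of the term
    \<open>- \<alpha> \<phi>\<close>.\<close>
  have A1: "((\<lambda>u. integral {c..d} (\<lambda>s. ?\<alpha> s * \<phi> s * max 0 (u - s))) has_real_derivative
      integral {c..t} (\<lambda>s. ?\<alpha> s * \<phi> s)) (at t)" if t: "t \<in> {c<..<d}" for t
  proof -
    have "((\<lambda>u. integral {c..d} (\<lambda>s. ?\<alpha> s * \<phi> s * max 0 (u - s))) has_real_derivative
      integral {c..d} (\<lambda>s. ?\<alpha> s * \<phi> s * (if s < t then 1 else 0))) (at t)"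
    proof (rule has_derivative_integral_lipschitz(1)[OF t, where L = b])
      fix s u v assume s: "s \<in> {c..d}"
      have "\<bar>?\<alpha> s * \<phi> s * max 0 (u - s) - ?\<alpha> s * \<phi> s * max 0 (v - s)\<bar>
          = \<bar>?\<alpha> s * \<phi> s\<bar> * \<bar>max 0 (u - s) - max 0 (v - s)\<bar>"
        by (simp add: right_diff_distrib[symmetric] abs_mult)
      also have "\<dots> \<le> b * \<bar>u - v\<bar>"
        using b[OF s] by (intro mult_mono) auto
      finally show "\<bar>?\<alpha> s * \<phi> s * max 0 (u - s) - ?\<alpha> s * \<phi> s * max 0 (v - s)\<bar> \<le> b * \<bar>u - v\<bar>" .
    next
      fix s assume "s \<in> {c..d} - {t}"
      then show "((\<lambda>u. ?\<alpha> s * \<phi> s * max 0 (u - s)) has_real_derivative ?\<alpha> s * \<phi> s * (if s < t then 1 else 0)) (at t)"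
        by (intro DERIV_cmult m_near) auto
    qed (rule integrable_continuous_real[OF A\<phi>])
    moreover have "integral {c..d} (\<lambda>s. ?\<alpha> s * \<phi> s * (if s < t then 1 else 0)) = integral {c..t} (\<lambda>s. ?\<alpha> s * \<phi> s)"
    proof -
      have "integral {c..d} (\<lambda>s. ?\<alpha> s * \<phi> s * (if s < t then 1 else 0))
          = integral {c..d} (\<lambda>s. if s \<in> {c..t} then ?\<alpha> s * \<phi> s else 0)"
        by (rule integral_spike[of "{t}"]) auto
      also have "\<dots> = integral ({c..t} \<inter> {c..d}) (\<lambda>s. ?\<alpha> s * \<phi> s)"
        by (rule integral_restrict_Int)
      also have "{c..t} \<inter> {c..d} = {c..t}" using t by auto
      finally show ?thesis .
    qed
    ultimately show ?thesis by simp
  qed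
  have A2: "((\<lambda>t. integral {c..t} (\<lambda>s. ?\<alpha> s * \<phi> s)) has_real_derivative ?\<alpha> t * \<phi> t) (at t)" if t: "t \<in> {c<..<d}" for t
  proof -
    have "((\<lambda>t. integral {c..t} (\<lambda>s. ?\<alpha> s * \<phi> s)) has_real_derivative ?\<alpha> t * \<phi> t) (at t within {c..d})"
      using t by (intro integral_has_real_derivative continuous_intros \<alpha>c \<phi>) auto
    then show ?thesis using t by (simp add: at_within_Icc_at)
  qed
  show thesis
  proof (rule that[of "\<lambda>t. integral {c..d} (\<lambda>s. S s t * \<phi> s) - integral {c..t} (\<lambda>s. ?\<alpha> s * \<phi> s)"])
    fix t assume t: "t \<in> {c<..<d}"
    have eq: "integral {c..d} (\<lambda>s. R s u * \<phi> s)
        = integral {c..d} (\<lambda>s. Q s u * \<phi> s) - integral {c..d} (\<lambda>s. ?\<alpha> s * \<phi> s * max 0 (u - s))"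
      if "u \<in> {c<..<d}" for u
      unfolding integral_diff[OF Q_int[OF that] integrable_continuous_real[OF A\<phi>], symmetric]
      by (simp add: Q_def algebra_simps)
    have "\<forall>\<^sub>F u in nhds t. u \<in> {c<..<d}" using t by (intro eventually_nhds_in_open) auto
    then have ev: "\<forall>\<^sub>F u in nhds t. integral {c..d} (\<lambda>s. R s u * \<phi> s)
        = integral {c..d} (\<lambda>s. Q s u * \<phi> s) - integral {c..d} (\<lambda>s. ?\<alpha> s * \<phi> s * max 0 (u - s))"
      by eventually_elim (rule eq)
    show "((\<lambda>t. integral {c..d} (\<lambda>s. R s t * \<phi> s)) has_real_derivative
        integral {c..d} (\<lambda>s. S s t * \<phi> s) - integral {c..t} (\<lambda>s. ?\<alpha> s * \<phi> s)) (at t)"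
      unfolding DERIV_cong_ev[OF refl ev refl] by (rule DERIV_diff[OF D1(1)[OF t] A1[OF t]])
    show "((\<lambda>t. integral {c..d} (\<lambda>s. S s t * \<phi> s) - integral {c..t} (\<lambda>s. ?\<alpha> s * \<phi> s)) has_real_derivative
        integral {c..d} (\<lambda>s. D2 (D2 R) s t * \<phi> s) - ?\<alpha> t * \<phi> t) (at t)"
      by (rule DERIV_diff[OF D2[OF t] A2[OF t]])
  qed
qed
end


section \<open>Error on one design interval\<close>

text \<open>Compare \<open>e\<close> with \<open>c * k\<close>, where \<open>k\<close> is the
  parabola with second derivative -1 vanishing at both ends, whose integral is
  \<open>(b - a)^3 / 12\<close>. The difference \<open>w\<close> vanishes at both ends too and has
  second derivative \<open>e'' + c\<close>, so it is at most
  \<open>\<delta> * (b - a)^2\<close>.\<close>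

lemma interpolation_integral_estimate:
  fixes e e' e'' \<phi> :: "real \<Rightarrow> real"
  assumes ab: "a < b" and e: "continuous_on {a..b} e" "e a = 0" "e b = 0"
    and d1: "\<And>t. t \<in> {a<..<b} \<Longrightarrow> (e has_real_derivative e' t) (at t)"
    and d2: "\<And>t. t \<in> {a<..<b} \<Longrightarrow> (e' has_real_derivative e'' t) (at t)"
    and bd: "\<And>t. t \<in> {a<..<b} \<Longrightarrow> \<bar>e'' t + c\<bar> \<le> \<delta>"
    and \<phi>: "continuous_on {a..b} \<phi>" "\<And>t. t \<in> {a..b} \<Longrightarrow> \<bar>\<phi> t\<bar> \<le> M"
      "\<And>t. t \<in> {a..b} \<Longrightarrow> \<bar>\<phi> t - \<phi> a\<bar> \<le> \<Lambda>"
  shows "\<bar>integral {a..b} (\<lambda>t. \<phi> t * e t) - c * \<phi> a * (b - a) ^ 3 / 12\<bar>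
    \<le> (b - a) * ((M * \<delta> + \<Lambda> * \<bar>c\<bar>) * (b - a)\<^sup>2)"
proof -
  define k where "k t = (t - a) * (b - t) / 2" for t
  define w where "w t = e t - c * k t" for t
  have kc: "continuous_on {a..b} k" unfolding k_def [abs_def] by (intro continuous_intros) auto
  have w_bd: "\<bar>w t\<bar> \<le> \<delta> * (b - a)\<^sup>2" if "t \<in> {a..b}" for t
  proof (rule second_order_vanishing_bound[OF ab _ _ _ _ _ _ that,
        where w' = "\<lambda>t. e' t - c * ((a + b) / 2 - t)" and w'' = "\<lambda>t. e'' t + c"])
    show "continuous_on {a..b} w" unfolding w_def [abs_def] by (intro continuous_intros e kc)
    show "w a = 0" "w b = 0" using e by (auto simp: w_def k_def)
    show "(w has_real_derivative e' t - c * ((a + b) / 2 - t)) (at t)" if "t \<in> {a<..<b}" for t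
      unfolding w_def [abs_def] k_def using d1[OF that]
      by (auto intro!: derivative_eq_intros simp: field_simps)
    show "((\<lambda>t. e' t - c * ((a + b) / 2 - t)) has_real_derivative e'' t + c) (at t)" if "t \<in> {a<..<b}" for t
      using d2[OF that] by (auto intro!: derivative_eq_intros)
  qed (use bd in auto)
  have k_bd: "\<bar>k t\<bar> \<le> (b - a)\<^sup>2" if "t \<in> {a..b}" for t
  proof -
    have "\<bar>k t\<bar> \<le> (t - a) * (b - t)" using that by (simp add: k_def abs_mult)
    also have "\<dots> \<le> (b - a) * (b - a)" using that by (intro mult_mono) auto
    finally show ?thesis by (simp add: power2_eq_square)
  qed
  \<comment> \<open>The antiderivative is \<open>- t^3 / 6 + (a + b) t^2 / 4 - a b t / 2\<close>;
    the next step factors its increment.\<close>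
  have "(k has_integral (- (b ^ 3) / 6 + (a + b) * b\<^sup>2 / 4 - a * b * b / 2) - (- (a ^ 3) / 6 + (a + b) * a\<^sup>2 / 4 - a * b * a / 2)) {a..b}"
    using ab by (intro fundamental_theorem_of_calculus)
      (auto simp: k_def has_real_derivative_iff_has_vector_derivative[symmetric] field_simps power2_eq_square
        intro!: derivative_eq_intros)
  also have "(- (b ^ 3) / 6 + (a + b) * b\<^sup>2 / 4 - a * b * b / 2) - (- (a ^ 3) / 6 + (a + b) * a\<^sup>2 / 4 - a * b * a / 2) = (b - a) ^ 3 / 12"
    by (simp add: power2_eq_square power3_eq_cube field_simps)
  finally have k_int: "(k has_integral (b - a) ^ 3 / 12) {a..b}" .
  have "integral {a..b} (\<lambda>t. \<phi> t * e t - c * \<phi> a * k t)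
      = integral {a..b} (\<lambda>t. \<phi> t * e t) - c * \<phi> a * (b - a) ^ 3 / 12"
    using integral_unique[OF k_int] has_integral_integrable[OF k_int]
      integrable_continuous_real[OF continuous_on_mult[OF \<phi>(1) e(1)]]
    by (subst integral_diff) (auto intro!: integrable_on_mult_right)
  moreover have "norm (integral {a..b} (\<lambda>t. \<phi> t * e t - c * \<phi> a * k t))
      \<le> ((M * \<delta> + \<Lambda> * \<bar>c\<bar>) * (b - a)\<^sup>2) * (b - a)"
  proof (rule integral_bound)
    show "continuous_on {a..b} (\<lambda>t. \<phi> t * e t - c * \<phi> a * k t)"
      by (intro continuous_intros \<phi> e kc)
    fix t assume t: "t \<in> {a..b}"
    \<comment> \<open>The first term carries the error of the parabola, the second that of freezing
      \<phi> at \<open>a\<close>; they account for the two summands of the bound.\<close>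
    have "\<phi> t * e t - c * \<phi> a * k t = \<phi> t * w t + (\<phi> t - \<phi> a) * (c * k t)"
      by (simp add: w_def algebra_simps)
    then have "\<bar>\<phi> t * e t - c * \<phi> a * k t\<bar> \<le> \<bar>\<phi> t\<bar> * \<bar>w t\<bar> + \<bar>\<phi> t - \<phi> a\<bar> * (\<bar>c\<bar> * \<bar>k t\<bar>)"
      by (simp add: abs_mult[symmetric] abs_triangle_ineq)
    also have "\<dots> \<le> M * (\<delta> * (b - a)\<^sup>2) + \<Lambda> * (\<bar>c\<bar> * (b - a)\<^sup>2)"
      using \<phi>(2,3)[OF t] w_bd[OF t] k_bd[OF t] by (intro add_mono mult_mono) auto
    also have "\<dots> = (M * \<delta> + \<Lambda> * \<bar>c\<bar>) * (b - a)\<^sup>2" by (simp add: algebra_simps)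
    finally show "norm (\<phi> t * e t - c * \<phi> a * k t) \<le> (M * \<delta> + \<Lambda> * \<bar>c\<bar>) * (b - a)\<^sup>2" by simp
  qed (use ab in auto)
  ultimately show ?thesis by (simp add: mult_ac)
qed

lemma abs_mult_diff_le:
  fixes a a' b b' :: real
  assumes "\<bar>a\<bar> \<le> A" "\<bar>b'\<bar> \<le> B" "\<bar>a - a'\<bar> \<le> d" "\<bar>b - b'\<bar> \<le> d'"
  shows "\<bar>a * b - a' * b'\<bar> \<le> A * d' + d * B"
proof -
  have "a * b - a' * b' = a * (b - b') + (a - a') * b'" by (simp add: algebra_simps)
  then have "\<bar>a * b - a' * b'\<bar> \<le> \<bar>a\<bar> * \<bar>b - b'\<bar> + \<bar>a - a'\<bar> * \<bar>b'\<bar>"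
    by (simp add: abs_mult[symmetric] abs_triangle_ineq)
  also have "\<dots> \<le> A * d' + d * B" using assms by (intro add_mono mult_mono) auto
  finally show ?thesis .
qed

lemma inverse_square_lipschitz:
  fixes y z :: real
  assumes "0 < c" "c \<le> y" "c \<le> z"
  shows "\<bar>1 / y\<^sup>2 - 1 / z\<^sup>2\<bar> \<le> 2 / c ^ 3 * \<bar>y - z\<bar>"
proof -
  have pos: "0 < y" "0 < z" using assms by auto
  have "1 / y\<^sup>2 - 1 / z\<^sup>2 = (z - y) * (1 / (y\<^sup>2 * z) + 1 / (y * z\<^sup>2))"
    using pos by (simp add: field_simps power2_eq_square)
  then have "\<bar>1 / y\<^sup>2 - 1 / z\<^sup>2\<bar> = \<bar>y - z\<bar> * (1 / (y\<^sup>2 * z) + 1 / (y * z\<^sup>2))"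
    using pos by (simp add: abs_mult abs_minus_commute)
  also have "\<dots> \<le> \<bar>y - z\<bar> * (1 / (c\<^sup>2 * c) + 1 / (c * c\<^sup>2))"
    using assms pos by (intro mult_left_mono add_mono divide_left_mono mult_mono power_mono mult_pos_pos) auto
  finally show ?thesis by (simp add: power2_eq_square power3_eq_cube mult_ac)
qed

text \<open>Two comparisons meet at \<open>c * \<phi> a * (b - a)^3 / 12\<close> with
  \<open>c = \<alpha> a * \<phi> a\<close>. First, the second derivative of \<open>e\<close> differs
  from \<open>- c\<close> by the variation of \<alpha>\<phi> over the interval and by
  \<open>r\<close>. Second, \<open>f \<xi> * (b - a) = 1 / n\<close> turns two of the three factors
  \<open>b - a\<close> into \<open>1 / (n * f \<xi>)\<close>, and the integrand
  \<open>\<alpha> \<phi>^2 / f^2\<close> varies little over the interval.\<close>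

lemma interval_error_estimate:
  fixes e e' \<phi> \<alpha> f r :: "real \<Rightarrow> real" and n :: nat
  assumes h: "0 < h" "h < 1" and ab: "a < b" "b - a \<le> D" and n: "0 < n"
    and e: "continuous_on {a..b} e" "e a = 0" "e b = 0"
    and d1: "\<And>t. t \<in> {a<..<b} \<Longrightarrow> (e has_real_derivative e' t) (at t)"
    and d2: "\<And>t. t \<in> {a<..<b} \<Longrightarrow> (e' has_real_derivative r t - \<alpha> t * \<phi> t) (at t)"
    and r: "\<And>t. t \<in> {a<..<b} \<Longrightarrow> \<bar>r t\<bar> \<le> \<rho>"
    and cont: "continuous_on {a..b} \<phi>" "continuous_on {a..b} \<alpha>" "continuous_on {a..b} f"
    and \<phi>: "\<And>t. t \<in> {a..b} \<Longrightarrow> \<bar>\<phi> t\<bar> \<le> M / h"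
      "\<And>s t. s \<in> {a..b} \<Longrightarrow> t \<in> {a..b} \<Longrightarrow> \<bar>\<phi> s - \<phi> t\<bar> \<le> L / h\<^sup>2 * \<bar>s - t\<bar>"
    and \<alpha>: "\<And>t. t \<in> {a..b} \<Longrightarrow> \<bar>\<alpha> t\<bar> \<le> A"
      "\<And>s t. s \<in> {a..b} \<Longrightarrow> t \<in> {a..b} \<Longrightarrow> \<bar>\<alpha> s - \<alpha> t\<bar> \<le> La * \<bar>s - t\<bar>"
    and f: "0 < cf" "\<And>t. t \<in> {a..b} \<Longrightarrow> cf \<le> f t"
      "\<And>s t. s \<in> {a..b} \<Longrightarrow> t \<in> {a..b} \<Longrightarrow> \<bar>f s - f t\<bar> \<le> Lf * \<bar>s - t\<bar>"
    and \<xi>: "\<xi> \<in> {a..b}" "f \<xi> * (b - a) = 1 / real n"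
    and nn: "0 \<le> M" "0 \<le> L" "0 \<le> A" "0 \<le> La" "0 \<le> Lf" "0 \<le> \<rho>"
  shows "\<bar>integral {a..b} (\<lambda>t. \<phi> t * e t) - 1 / (12 * (real n)\<^sup>2) * integral {a..b} (\<lambda>t. \<alpha> t / (f t)\<^sup>2 * (\<phi> t)\<^sup>2)\<bar>
    \<le> (b - a) * (D\<^sup>2 * ((2 * M * A * L + M\<^sup>2 * La) * D / h ^ 3 + M * \<rho> / h)
        + 1 / (12 * (real n)\<^sup>2) * (((2 * M * A * L + M\<^sup>2 * La) / cf\<^sup>2 + 2 * A * M\<^sup>2 * Lf / cf ^ 3) * D / h ^ 3))"
proof -
  let ?G = "2 * M * A * L + M\<^sup>2 * La"
  define c where "c = \<alpha> a * \<phi> a"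
  have a: "a \<in> {a..b}" using ab by auto
  have D: "0 < D" using ab by simp
  \<comment> \<open>As \<open>h < 1\<close>, lower negative powers of \<open>h\<close> are bounded
    by higher ones, which lets variation terms be collected over a common denominator.\<close>
  have hp: "1 / h \<le> 1 / h\<^sup>2" "1 / h\<^sup>2 \<le> 1 / h ^ 3"
    using h power_decreasing[of 1 2 h] power_decreasing[of 2 3 h] by (auto intro!: divide_left_mono)
  have near: "\<bar>s - t\<bar> \<le> D" if "s \<in> {a..b}" "t \<in> {a..b}" for s t using that ab by auto
  have \<phi>D: "\<bar>\<phi> s - \<phi> t\<bar> \<le> L / h\<^sup>2 * D" if "s \<in> {a..b}" "t \<in> {a..b}" for s t
    by (rule order_trans[OF \<phi>(2)[OF that] mult_left_mono[OF near[OF that]]]) (use nn in auto)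
  have \<alpha>D: "\<bar>\<alpha> s - \<alpha> t\<bar> \<le> La * D" if "s \<in> {a..b}" "t \<in> {a..b}" for s t
    by (rule order_trans[OF \<alpha>(2)[OF that] mult_left_mono[OF near[OF that]]]) (use nn in auto)
  have fD: "\<bar>f s - f t\<bar> \<le> Lf * D" if "s \<in> {a..b}" "t \<in> {a..b}" for s t
    by (rule order_trans[OF f(3)[OF that] mult_left_mono[OF near[OF that]]]) (use nn in auto)
  have c_bd: "\<bar>c\<bar> \<le> A * (M / h)"
    unfolding c_def abs_mult using \<alpha>(1)[OF a] \<phi>(1)[OF a] nn by (intro mult_mono) auto
  define \<delta> where "\<delta> = (A * L + La * M) / h\<^sup>2 * D + \<rho>"
  have e''_bd: "\<bar>(r t - \<alpha> t * \<phi> t) + c\<bar> \<le> \<delta>" if t: "t \<in> {a<..<b}" for t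
  proof -
    have t': "t \<in> {a..b}" using t by auto
    have "\<bar>\<alpha> a * \<phi> a - \<alpha> t * \<phi> t\<bar> \<le> A * (L / h\<^sup>2 * D) + (La * D) * (M / h)"
      by (intro abs_mult_diff_le \<alpha>(1) \<phi>(1) \<alpha>D \<phi>D a t')
    also have "\<dots> = A * L / h\<^sup>2 * D + La * M * D * (1 / h)" by (simp add: mult_ac)
    also have "\<dots> \<le> A * L / h\<^sup>2 * D + La * M * D * (1 / h\<^sup>2)"
      using nn D by (intro add_left_mono mult_left_mono hp) auto
    also have "\<dots> = (A * L + La * M) / h\<^sup>2 * D" by (simp add: add_divide_distrib algebra_simps)
    finally show ?thesis using r[OF t] unfolding \<delta>_def c_def by linarith
  qed
  have "\<bar>integral {a..b} (\<lambda>t. \<phi> t * e t) - c * \<phi> a * (b - a) ^ 3 / 12\<bar>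
      \<le> (b - a) * ((M / h * \<delta> + (L / h\<^sup>2 * D) * \<bar>c\<bar>) * (b - a)\<^sup>2)"
    by (rule interpolation_integral_estimate[OF ab(1) e d1 d2 e''_bd cont(1) \<phi>(1) \<phi>D[OF _ a]])
  also have "\<dots> \<le> (b - a) * ((M / h * \<delta> + (L / h\<^sup>2 * D) * (A * (M / h))) * D\<^sup>2)"
  proof -
    have "0 \<le> \<delta>" using nn D h by (auto simp: \<delta>_def)
    then show ?thesis
      using nn D h ab c_bd by (intro mult_left_mono mult_mono add_left_mono power_mono) auto
  qed
  also have "M / h * \<delta> + (L / h\<^sup>2 * D) * (A * (M / h)) = ?G * D / h ^ 3 + M * \<rho> / h"
    using h by (simp add: \<delta>_def power2_eq_square power3_eq_cube field_simps)
  finally have part1: "\<bar>integral {a..b} (\<lambda>t. \<phi> t * e t) - c * \<phi> a * (b - a) ^ 3 / 12\<bar>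
      \<le> (b - a) * (D\<^sup>2 * (?G * D / h ^ 3 + M * \<rho> / h))" by (simp add: mult_ac)
  let ?\<psi> = "\<lambda>t. \<alpha> t / (f t)\<^sup>2 * (\<phi> t)\<^sup>2"
  let ?E = "(?G / cf\<^sup>2 + 2 * A * M\<^sup>2 * Lf / cf ^ 3) * D / h ^ 3"
  have fpos: "0 < f t" if "t \<in> {a..b}" for t using f(1) f(2)[OF that] by simp
  have \<psi>c: "continuous_on {a..b} ?\<psi>"
    using fpos by (intro continuous_intros cont) force
  \<comment> \<open>\<alpha> and \<phi> are frozen at \<open>a\<close> but \<open>f\<close> at
    \<open>\<xi>\<close>, the point where the density gives the length of the interval
    exactly.\<close>
  have pt: "\<bar>\<alpha> a * (\<phi> a)\<^sup>2 * (1 / (f \<xi>)\<^sup>2) - ?\<psi> t\<bar> \<le> ?E" if t: "t \<in> {a..b}" for t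
  proof -
    have sq: "\<bar>\<phi> a * \<phi> a - \<phi> t * \<phi> t\<bar> \<le> M / h * (L / h\<^sup>2 * D) + (L / h\<^sup>2 * D) * (M / h)"
      by (intro abs_mult_diff_le \<phi>(1) \<phi>D a t)
    have "\<bar>\<phi> t * \<phi> t\<bar> \<le> M / h * (M / h)" if "t \<in> {a..b}" for t
      unfolding abs_mult using \<phi>(1)[OF that] nn h by (intro mult_mono) auto
    then have sqb: "\<bar>\<phi> t * \<phi> t\<bar> \<le> M\<^sup>2 / h\<^sup>2" if "t \<in> {a..b}" for t using that by (simp add: power2_eq_square)
    have "\<bar>\<alpha> a * (\<phi> a * \<phi> a) - \<alpha> t * (\<phi> t * \<phi> t)\<bar>
        \<le> A * (M / h * (L / h\<^sup>2 * D) + (L / h\<^sup>2 * D) * (M / h)) + (La * D) * (M\<^sup>2 / h\<^sup>2)"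
      by (intro abs_mult_diff_le \<alpha>(1) \<alpha>D sq sqb a t)
    also have "\<dots> = 2 * M * A * L * D / h ^ 3 + La * D * M\<^sup>2 * (1 / h\<^sup>2)"
      using h by (simp add: power2_eq_square power3_eq_cube field_simps)
    also have "\<dots> \<le> 2 * M * A * L * D / h ^ 3 + La * D * M\<^sup>2 * (1 / h ^ 3)"
      using nn D by (intro add_left_mono mult_left_mono hp) auto
    also have "\<dots> = ?G * D / h ^ 3" by (simp add: add_divide_distrib algebra_simps)
    finally have N: "\<bar>\<alpha> a * (\<phi> a * \<phi> a) - \<alpha> t * (\<phi> t * \<phi> t)\<bar> \<le> ?G * D / h ^ 3" .
    have Nb: "\<bar>\<alpha> a * (\<phi> a * \<phi> a)\<bar> \<le> A * (M\<^sup>2 / h\<^sup>2)"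
      unfolding abs_mult[of "\<alpha> a"] using \<alpha>(1)[OF a] sqb[OF a] nn by (intro mult_mono) auto
    have i1: "\<bar>1 / (f t)\<^sup>2\<bar> \<le> 1 / cf\<^sup>2"
      using f(1) f(2)[OF t] fpos[OF t] by (auto intro!: divide_left_mono power_mono mult_pos_pos)
    have "\<bar>1 / (f \<xi>)\<^sup>2 - 1 / (f t)\<^sup>2\<bar> \<le> 2 / cf ^ 3 * \<bar>f \<xi> - f t\<bar>"
      by (intro inverse_square_lipschitz f \<xi> t)
    also have "\<dots> \<le> 2 / cf ^ 3 * (Lf * D)" using fD[OF \<xi>(1) t] f(1) by (intro mult_left_mono) auto
    finally have i2: "\<bar>1 / (f \<xi>)\<^sup>2 - 1 / (f t)\<^sup>2\<bar> \<le> 2 / cf ^ 3 * (Lf * D)" .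
    have "\<bar>\<alpha> a * (\<phi> a * \<phi> a) * (1 / (f \<xi>)\<^sup>2) - \<alpha> t * (\<phi> t * \<phi> t) * (1 / (f t)\<^sup>2)\<bar>
        \<le> A * (M\<^sup>2 / h\<^sup>2) * (2 / cf ^ 3 * (Lf * D)) + ?G * D / h ^ 3 * (1 / cf\<^sup>2)"
      by (rule abs_mult_diff_le[OF Nb i1 N i2])
    also have "\<dots> = 2 * A * M\<^sup>2 * Lf / cf ^ 3 * D * (1 / h\<^sup>2) + ?G / cf\<^sup>2 * D / h ^ 3" by (simp add: mult_ac)
    also have "\<dots> \<le> 2 * A * M\<^sup>2 * Lf / cf ^ 3 * D * (1 / h ^ 3) + ?G / cf\<^sup>2 * D / h ^ 3"
      using nn D f(1) by (intro add_right_mono mult_left_mono hp) auto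
    also have "\<dots> = ?E" by (simp add: add_divide_distrib algebra_simps)
    finally show ?thesis by (simp add: power2_eq_square)
  qed
  have bnd: "norm (integral {a..b} (\<lambda>t. \<alpha> a * (\<phi> a)\<^sup>2 * (1 / (f \<xi>)\<^sup>2) - ?\<psi> t)) \<le> ?E * (b - a)"
    using pt ab \<psi>c by (intro integral_bound) (auto intro!: continuous_intros simp del: times_divide_eq_right)
  have int_eq: "integral {a..b} (\<lambda>t. \<alpha> a * (\<phi> a)\<^sup>2 * (1 / (f \<xi>)\<^sup>2) - ?\<psi> t)
      = (b - a) * (\<alpha> a * (\<phi> a)\<^sup>2 * (1 / (f \<xi>)\<^sup>2)) - integral {a..b} ?\<psi>"
    using ab integrable_continuous_real[OF \<psi>c] by (subst integral_diff) auto
  have inv: "1 / (f \<xi>)\<^sup>2 = (real n)\<^sup>2 * (b - a)\<^sup>2"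
    using \<xi>(2) n fpos[OF \<xi>(1)] ab by (simp add: field_simps flip: power_mult_distrib)
  have "(b - a) * (\<alpha> a * (\<phi> a)\<^sup>2 * (1 / (f \<xi>)\<^sup>2)) = (real n)\<^sup>2 * (c * \<phi> a * (b - a) ^ 3)"
    unfolding inv by (simp add: c_def power2_eq_square power3_eq_cube mult_ac)
  with bnd have "\<bar>(real n)\<^sup>2 * (c * \<phi> a * (b - a) ^ 3) - integral {a..b} ?\<psi>\<bar> \<le> ?E * (b - a)"
    unfolding int_eq real_norm_def by simp
  moreover have "c * \<phi> a * (b - a) ^ 3 / 12 - 1 / (12 * (real n)\<^sup>2) * integral {a..b} ?\<psi>
      = 1 / (12 * (real n)\<^sup>2) * ((real n)\<^sup>2 * (c * \<phi> a * (b - a) ^ 3) - integral {a..b} ?\<psi>)"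
    using n by (simp add: field_simps)
  ultimately have part2: "\<bar>c * \<phi> a * (b - a) ^ 3 / 12 - 1 / (12 * (real n)\<^sup>2) * integral {a..b} ?\<psi>\<bar>
      \<le> 1 / (12 * (real n)\<^sup>2) * (?E * (b - a))"
    unfolding abs_mult by (simp only: abs_mult) (intro mult_mono, auto)
  have "(b - a) * (D\<^sup>2 * (?G * D / h ^ 3 + M * \<rho> / h) + 1 / (12 * (real n)\<^sup>2) * ?E)
      = (b - a) * (D\<^sup>2 * (?G * D / h ^ 3 + M * \<rho> / h)) + 1 / (12 * (real n)\<^sup>2) * (?E * (b - a))"
    by (simp only: distrib_left mult_ac)
  then show ?thesis using part1 part2 by linarith
qed

section \<open>Design density and design points\<close>

lemma design_density_bounds:
  assumes "design_density f"
  obtains c L where "0 < c" "continuous_on {0..1} f" "\<And>t. t \<in> {0..1} \<Longrightarrow> c \<le> f t"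
    "\<And>s t. s \<in> {0..1} \<Longrightarrow> t \<in> {0..1} \<Longrightarrow> \<bar>f s - f t\<bar> \<le> L * \<bar>s - t\<bar>" "0 \<le> L"
proof -
  obtain f' f'' where d: "\<And>t. t \<in> {0..1} \<Longrightarrow> (f has_real_derivative f' t) (at t within {0..1})"
    "\<And>t. t \<in> {0..1} \<Longrightarrow> (f' has_real_derivative f'' t) (at t within {0..1})"
    using assms unfolding design_density_def C2_on_def by blast
  obtain c where c: "0 < c" "\<And>t. t \<in> {0<..<1} \<Longrightarrow> c \<le> f t"
    using assms unfolding design_density_def by blast
  have cf: "continuous_on {0..1} f" and cf': "continuous_on {0..1} f'"
    by (rule DERIV_continuous_on[OF d(1)], assumption, rule DERIV_continuous_on[OF d(2)])
  have "c \<le> f t" if "t \<in> {0..1}" for t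
    by (rule continuous_ge_on_closure[of "{0<..<1}" f]) (use cf c that in auto)
  moreover obtain L where L: "\<And>t. t \<in> {0..1} \<Longrightarrow> \<bar>f' t\<bar> \<le> L"
    using compact_imp_bounded[OF compact_continuous_image[OF cf']] unfolding bounded_iff by force
  have "\<bar>f v - f u\<bar> \<le> L * (v - u)" if "u \<in> {0..1}" "v \<in> {0..1}" "u \<le> v" for u v
  proof (rule lipschitz_except_point[where s = u])
    show "continuous_on {u..v} f" by (rule continuous_on_subset[OF cf]) (use that in auto)
    fix t assume t: "t \<in> {u<..<v} - {u}"
    then have t': "0 < t" "t < 1" using that by auto
    then show "(f has_real_derivative f' t) (at t)" using d(1)[of t] at_within_Icc_at[of 0 t 1] by simp
    show "\<bar>f' t\<bar> \<le> L" using L t' by simp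
  qed (use that in auto)
  then have "\<bar>f s - f t\<bar> \<le> L * \<bar>s - t\<bar>" if "s \<in> {0..1}" "t \<in> {0..1}" for s t
    using that by (cases "s \<le> t") (force simp: abs_minus_commute)+
  moreover have "0 \<le> L" using L[of 0] by simp
  ultimately show thesis using that c(1) cf by blast
qed

text \<open>The distribution function \<open>F\<close> is continuous and strictly increasing from 0
  to 1, so its inverse is defined at every \<open>i / n\<close>; the last claim is the mean value
  theorem for \<open>F\<close>. Index 0 does not belong to the design: its point is included so that
  consecutive points partition the unit interval.\<close>

lemma design_point_properties:
  assumes f: "design_density f" and n: "0 < n"
  shows "design_point f n 0 = 0" "design_point f n n = 1"
    and "\<And>i. i \<le> n \<Longrightarrow> design_point f n i \<in> {0..1}"
    and "\<And>i j. i < j \<Longrightarrow> j \<le> n \<Longrightarrow> design_point f n i < design_point f n j"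
    and "\<And>i. i < n \<Longrightarrow> \<exists>\<xi>\<in>{design_point f n i..design_point f n (Suc i)}.
            f \<xi> * (design_point f n (Suc i) - design_point f n i) = 1 / real n"
proof -
  let ?T = "design_point f n"
  define F where "F t = integral {0..t} f" for t
  obtain c where c: "0 < c" and cf: "continuous_on {0..1} f" and cle: "\<And>t. t \<in> {0..1} \<Longrightarrow> c \<le> f t"
    by (rule design_density_bounds[OF f]) blast
  have F_der: "(F has_real_derivative f t) (at t within {0..1})" if "t \<in> {0..1}" for t
    unfolding F_def [abs_def] by (rule integral_has_real_derivative[OF cf that])
  have Fc: "continuous_on {0..1} F" by (rule DERIV_continuous_on[OF F_der])
  have mvt: "\<exists>\<xi>\<in>{a..b}. F b - F a = f \<xi> * (b - a)" if ab: "a \<in> {0..1}" "b \<in> {0..1}" "a < b" for a b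
  proof -
    have "continuous_on {a..b} F" by (rule continuous_on_subset[OF Fc]) (use ab in auto)
    moreover have "(F has_real_derivative f t) (at t)" if "t \<in> {a<..<b}" for t
      using F_der[of t] at_within_Icc_at[of 0 t 1] that ab by auto
    ultimately obtain \<xi> where "\<xi> \<in> {a<..<b}" "F b - F a = f \<xi> * (b - a)"
      by (rule mvt_real_derivative[OF ab(3)])
    then show ?thesis by (intro bexI[of _ \<xi>]) auto
  qed
  have mono: "F a < F b" if ab: "a \<in> {0..1}" "b \<in> {0..1}" "a < b" for a b
  proof -
    obtain \<xi> where \<xi>: "\<xi> \<in> {a..b}" "F b - F a = f \<xi> * (b - a)" using mvt[OF ab] by blast
    then have "0 < f \<xi>" using cle[of \<xi>] c ab by auto
    then have "0 < f \<xi> * (b - a)" using ab by simp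
    then show ?thesis using \<xi>(2) by linarith
  qed
  have inj: "inj_on F {0..1}"
    by (rule inj_onI) (metis mono linorder_neq_iff)
  have F01: "F 0 = 0" "F 1 = 1"
    using f unfolding F_def design_density_def by auto
  have T_def: "?T i = the_inv_into {0..1} F (real i / real n)" for i
    by (simp add: design_point_def F_def [abs_def])
  show "?T 0 = 0" unfolding T_def by (rule the_inv_into_f_eq[OF inj]) (use F01 in auto)
  show "?T n = 1" unfolding T_def by (rule the_inv_into_f_eq[OF inj]) (use F01 n in auto)
  have im: "real i / real n \<in> F ` {0..1}" if "i \<le> n" for i
  proof -
    have "\<exists>t\<ge>0. t \<le> 1 \<and> F t = real i / real n"
      by (rule IVT') (use that n F01 Fc in auto)
    then show ?thesis by force
  qed
  show T01: "?T i \<in> {0..1}" if "i \<le> n" for i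
    unfolding T_def by (rule the_inv_into_into[OF inj im[OF that]]) simp
  have FT: "F (?T i) = real i / real n" if "i \<le> n" for i
    unfolding T_def by (rule f_the_inv_into_f[OF inj im[OF that]])
  show lt: "?T i < ?T j" if ij: "i < j" "j \<le> n" for i j
  proof (rule ccontr)
    assume "\<not> ?T i < ?T j"
    then have "F (?T j) \<le> F (?T i)"
      using mono[of "?T j" "?T i"] T01[of i] T01[of j] ij by (cases "?T j = ?T i") auto
    then show False using FT[of i] FT[of j] ij n by (simp add: divide_le_cancel)
  qed
  show "\<exists>\<xi>\<in>{?T i..?T (Suc i)}. f \<xi> * (?T (Suc i) - ?T i) = 1 / real n" if "i < n" for i
    using mvt[OF T01[of i] T01[of "Suc i"] lt[of i "Suc i"]] FT[of i] FT[of "Suc i"] that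
    by (auto simp: diff_divide_distrib[symmetric])
qed


section \<open>Total projection error\<close>

lemma integral_vanishing_outside:
  fixes g :: "real \<Rightarrow> real"
  assumes "{c..d} \<subseteq> {a..b}" "\<And>t. t \<in> {a..b} - {c..d} \<Longrightarrow> g t = 0"
  shows "integral {a..b} g = integral {c..d} g"
    and "g integrable_on {c..d} \<Longrightarrow> g integrable_on {a..b}"
proof -
  have neg: "negligible {t \<in> {a..b} - {c..d}. g t \<noteq> 0}" "negligible {t \<in> {c..d} - {a..b}. g t \<noteq> 0}"
  proof -
    have eq: "{t \<in> {a..b} - {c..d}. g t \<noteq> 0} = {}" "{t \<in> {c..d} - {a..b}. g t \<noteq> 0} = {}"
      using assms by blast+
    show "negligible {t \<in> {a..b} - {c..d}. g t \<noteq> 0}" "negligible {t \<in> {c..d} - {a..b}. g t \<noteq> 0}"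
      unfolding eq by (rule negligible_empty)+
  qed
  show "integral {a..b} g = integral {c..d} g" by (rule integral_spike_set[OF neg])
  show "g integrable_on {c..d} \<Longrightarrow> g integrable_on {a..b}" by (rule integrable_spike_set[OF _ neg(2,1)])
qed

text \<open>The second claim still has \<open>sqrt V\<close> on its right, from the bound on
  \<open>r\<close>; the other two claims serve to remove it afterwards. By \<open>mesh\<close> every
  design interval has length at most \<open>h\<close>, so those meeting the support of \<phi> lie in
  the window from \<open>x - 2 * h\<close> to \<open>x + 2 * h\<close>, whose length is the factor
  \<open>4 * h\<close>.\<close>

lemma (in rkhs_covariance) projection_error_estimate:
  fixes K f :: "real \<Rightarrow> real" and x h M L A La Lf cf :: real and n :: nat
  assumes ns: "nonsingular_kernel R" and f: "design_density f"
    and n: "0 < n" and h: "0 < h" "h < 1" "0 < x - 2 * h" "x + 2 * h < 1"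
    and K: "continuous_on UNIV K" "\<And>u. 1 < \<bar>u\<bar> \<Longrightarrow> K u = 0"
      "\<And>u. u \<in> {-2..2} \<Longrightarrow> \<bar>K u\<bar> \<le> M"
      "\<And>u v. u \<in> {-2..2} \<Longrightarrow> v \<in> {-2..2} \<Longrightarrow> \<bar>K u - K v\<bar> \<le> L * \<bar>u - v\<bar>"
    and \<alpha>: "\<And>t. t \<in> {0<..<1} \<Longrightarrow> \<bar>alpha R t\<bar> \<le> A"
      "\<And>s t. s \<in> {0<..<1} \<Longrightarrow> t \<in> {0<..<1} \<Longrightarrow> \<bar>alpha R s - alpha R t\<bar> \<le> La * \<bar>s - t\<bar>"
    and cf: "0 < cf" "\<And>t. t \<in> {0..1} \<Longrightarrow> cf \<le> f t" and f_cont: "continuous_on {0..1} f"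
    and Lf: "\<And>s t. s \<in> {0..1} \<Longrightarrow> t \<in> {0..1} \<Longrightarrow> \<bar>f s - f t\<bar> \<le> Lf * \<bar>s - t\<bar>"
    and nn: "0 \<le> M" "0 \<le> L" "0 \<le> A" "0 \<le> La" "0 \<le> Lf"
    and mesh: "1 / (cf * real n) \<le> h"
  defines "ts \<equiv> design f n"
  defines "w \<equiv> vec_index (projection_weights R K x h ts)"
  defines "V \<equiv> sigma_sq R K x h - (\<Sum>i<n. \<Sum>j<n. w i * w j * R (ts ! i) (ts ! j))"
  shows "0 \<le> V"
    and "\<bar>V - 1 / (12 * (real n)\<^sup>2) * integral {x - h..x + h} (\<lambda>t. alpha R t / (f t)\<^sup>2 * (phi K x h t)\<^sup>2)\<bar>
      \<le> 4 * h * ((1 / (cf * real n))\<^sup>2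
            * ((2 * M * A * L + M\<^sup>2 * La) * (1 / (cf * real n)) / h ^ 3 + M * (C0 * sqrt V) / h)
          + 1 / (12 * (real n)\<^sup>2) * (((2 * M * A * L + M\<^sup>2 * La) / cf\<^sup>2 + 2 * A * M\<^sup>2 * Lf / cf ^ 3)
            * (1 / (cf * real n)) / h ^ 3))"
    and "\<bar>integral {x - h..x + h} (\<lambda>t. alpha R t / (f t)\<^sup>2 * (phi K x h t)\<^sup>2)\<bar> \<le> 2 * A * M\<^sup>2 / cf\<^sup>2 / h"
proof -
  define \<phi> where "\<phi> = phi K x h"
  define T where "T = design_point f n"
  define D where "D = 1 / (cf * real n)"
  let ?c = "x - 2 * h" and ?d = "x + 2 * h"
  note T = design_point_properties[OF f n, folded T_def]
  have cd: "0 < ?c" "?c < ?d" "?d < 1" using h by auto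
  \<comment> \<open>List positions start at 0 while the design starts at \<open>T 1\<close>, hence
    the shift.\<close>
  have tsT: "ts ! j = T (Suc j)" if "j < n" for j
    using n that by (auto simp: ts_def design_def T_def simp del: upt_Suc)
  have len: "length ts = n" by (simp add: ts_def design_def)
  have ts01: "ts ! j \<in> {0..1}" if "j < n" for j using tsT[OF that] T(3) that by simp
  have set_ts: "set ts \<subseteq> {0..1}" using ts01 len by (auto simp: in_set_conv_nth)
  have inj: "T i \<noteq> T j" if "i \<le> n" "j \<le> n" "i \<noteq> j" for i j
    using T(4)[of i j] T(4)[of j i] that by (cases i j rule: linorder_cases) auto
  have dist: "distinct ts"
    unfolding distinct_conv_nth len using tsT inj by auto
  have w_solve: "(\<Sum>i<n. w i * R (ts ! i) (ts ! j)) = smoothed_cov R K x h (ts ! j)" if "j < n" for j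
    using projection_weights_solve[OF ns dist set_ts, of j K x h] that len by (simp add: w_def)

  \<comment> \<open>Size and smoothness of the rescaled kernel\<close>
  have \<phi>_cont: "continuous_on S \<phi>" for S
    unfolding \<phi>_def phi_def [abs_def]
    by (intro continuous_intros continuous_on_compose2[OF K(1)]) (use h in auto)
  have \<phi>0: "\<phi> t = 0" if "t \<notin> {x - h..x + h}" for t
  proof -
    have "h < \<bar>x - t\<bar>" using that by auto
    then have "1 < \<bar>(x - t) / h\<bar>" using h by (simp add: abs_divide)
    then show ?thesis using K(2) by (simp add: \<phi>_def phi_def)
  qed
  have arg: "(x - t) / h \<in> {-2..2}" if "t \<in> {?c..?d}" for t
    using that h by (auto simp: field_simps)
  have \<phi>M: "\<bar>\<phi> t\<bar> \<le> M / h" if "t \<in> {?c..?d}" for t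
    using K(3)[OF arg[OF that]] h by (simp add: \<phi>_def phi_def abs_mult divide_right_mono)
  have \<phi>L: "\<bar>\<phi> s - \<phi> t\<bar> \<le> L / h\<^sup>2 * \<bar>s - t\<bar>" if "s \<in> {?c..?d}" "t \<in> {?c..?d}" for s t
  proof -
    have "\<bar>\<phi> s - \<phi> t\<bar> = 1 / h * \<bar>K ((x - s) / h) - K ((x - t) / h)\<bar>"
      using h by (simp add: \<phi>_def phi_def abs_divide flip: diff_divide_distrib)
    also have "\<dots> \<le> 1 / h * (L * \<bar>(x - s) / h - (x - t) / h\<bar>)"
      using h by (intro mult_left_mono K(4) arg that) auto
    also have "\<bar>(x - s) / h - (x - t) / h\<bar> = \<bar>s - t\<bar> / h"
      using h by (simp add: abs_divide abs_minus_commute flip: diff_divide_distrib)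
    finally show ?thesis using h by (simp add: power2_eq_square mult_ac)
  qed

  \<comment> \<open>The projection error and its squared norm\<close>
  define e where "e t = smoothed_cov R K x h t - (\<Sum>j<n. w j * R (ts ! j) t)" for t
  have e0: "e (ts ! j) = 0" if "j < n" for j using w_solve[OF that] by (simp add: e_def)
  have sc: "smoothed_cov R K x h t = integral {0..1} (\<lambda>s. R s t * \<phi> s)" for t
    by (simp add: smoothed_cov_def \<phi>_def)
  have sc_cont: "continuous_on {0..1} (smoothed_cov R K x h)"
  proof -
    have "continuous_on ({0..1} \<times> {0..1}) (\<lambda>z. R (snd z) (fst z))"
      using continuous_on_compose2[OF R_cont continuous_on_Pair[OF continuous_on_snd[OF continuous_on_id] continuous_on_fst[OF continuous_on_id]], of "{0..1} \<times> {0..1}"]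
      by (auto simp: image_subset_iff)
    then have "continuous_on ({0..1} \<times> {0..1}) (\<lambda>(t, s). R s t * \<phi> s)"
      unfolding case_prod_unfold
      by (intro continuous_intros continuous_on_compose2[OF \<phi>_cont[of UNIV]]) auto
    then show ?thesis
      using integral_continuous_on_param[of "{0..1}" 0 1 "\<lambda>t s. R s t * \<phi> s"] by (simp add: sc[abs_def])
  qed
  have e_cont: "continuous_on {0..1} e"
    unfolding e_def [abs_def] by (intro continuous_intros sc_cont R_cont_snd ts01) auto

  \<comment> \<open>By the normal equations the quadratic form in the weights equals the pairing of
    the weights with the smoothed covariance. Hence \<open>V\<close>, defined as \<sigma>^2 minus
    the form, is also \<sigma>^2 minus twice the pairing plus the form, the shape of the squared
    norm in \<open>RKHS_integral_functional_bound\<close>.\<close>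
  have ww: "(\<Sum>i<n. \<Sum>j<n. w i * w j * R (ts ! i) (ts ! j)) = (\<Sum>j<n. w j * smoothed_cov R K x h (ts ! j))"
  proof -
    have "(\<Sum>i<n. \<Sum>j<n. w i * w j * R (ts ! i) (ts ! j)) = (\<Sum>j<n. w j * (\<Sum>i<n. w i * R (ts ! i) (ts ! j)))"
      by (subst sum.swap) (simp add: sum_distrib_left mult_ac)
    then show ?thesis using w_solve by simp
  qed
  have V_eq: "V = integral {0..1} (\<lambda>s. integral {0..1} (\<lambda>t. \<phi> s * R s t * \<phi> t))
      - 2 * (\<Sum>j<n. w j * integral {0..1} (\<lambda>s. R s (ts ! j) * \<phi> s))
      + (\<Sum>i<n. \<Sum>j<n. w i * w j * R (ts ! i) (ts ! j))"
    unfolding V_def sigma_sq_def ww sc by (simp add: \<phi>_def)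
  have R02_functional: "(integral {0..1} (\<lambda>s. \<phi> s * v s) - (\<Sum>j<n. w j * v (ts ! j)))\<^sup>2 \<le> ip v v * V"
    and V0: "0 \<le> V" if "v \<in> H" for v
    unfolding V_eq by (rule RKHS_integral_functional_bound[OF rk R_cont sym \<phi>_cont ts01 that]; assumption)+
  show V_nonneg: "0 \<le> V" using V0[OF R02_in[of 0]] by simp
  \<comment> \<open>As an integral over \<open>t\<close>, \<open>V\<close> can be split along the
    design intervals.\<close>
  have V_int: "V = integral {0..1} (\<lambda>t. \<phi> t * e t)"
  proof -
    have "sigma_sq R K x h = integral {0..1} (\<lambda>s. \<phi> s * smoothed_cov R K x h s)"
      unfolding sigma_sq_def sc \<phi>_def [symmetric] integral_mult_right[symmetric]
      by (intro integral_cong) (auto simp: sym)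
    moreover have "smoothed_cov R K x h (ts ! j) = integral {0..1} (\<lambda>t. \<phi> t * R (ts ! j) t)" if "j < n" for j
      unfolding sc using sym ts01[OF that] by (intro integral_cong) (auto simp: mult.commute)
    moreover have "integral {0..1} (\<lambda>t. \<phi> t * e t) = integral {0..1} (\<lambda>s. \<phi> s * smoothed_cov R K x h s)
        - (\<Sum>j<n. w j * integral {0..1} (\<lambda>t. \<phi> t * R (ts ! j) t))"
    proof -
      have c1: "(\<lambda>t. \<phi> t * smoothed_cov R K x h t) integrable_on {0..1}"
        by (intro integrable_continuous_real continuous_intros \<phi>_cont sc_cont)
      have c2: "(\<lambda>t. w j * (\<phi> t * R (ts ! j) t)) integrable_on {0..1}" if "j < n" for j
        by (intro integrable_continuous_real continuous_intros \<phi>_cont R_cont_snd ts01 that)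
      have "integral {0..1} (\<lambda>t. \<phi> t * e t)
          = integral {0..1} (\<lambda>t. \<phi> t * smoothed_cov R K x h t - (\<Sum>j<n. w j * (\<phi> t * R (ts ! j) t)))"
        by (simp add: e_def right_diff_distrib sum_distrib_left mult_ac)
      also have "\<dots> = integral {0..1} (\<lambda>t. \<phi> t * smoothed_cov R K x h t)
          - (\<Sum>j<n. integral {0..1} (\<lambda>t. w j * (\<phi> t * R (ts ! j) t)))"
      proof -
        have "(\<lambda>t. \<Sum>j<n. w j * (\<phi> t * R (ts ! j) t)) integrable_on {0..1}"
          by (rule Henstock_Kurzweil_Integration.integrable_sum) (use c2 in auto)
        moreover have "integral {0..1} (\<lambda>t. \<Sum>j<n. w j * (\<phi> t * R (ts ! j) t))
            = (\<Sum>j<n. integral {0..1} (\<lambda>t. w j * (\<phi> t * R (ts ! j) t)))"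
          by (rule Henstock_Kurzweil_Integration.integral_sum) (use c2 in auto)
        ultimately show ?thesis
          using Henstock_Kurzweil_Integration.integral_diff[OF c1] by simp
      qed
      finally show ?thesis by simp
    qed
    ultimately show ?thesis unfolding V_def ww by simp
  qed

  \<comment> \<open>Second derivative of the projection error\<close>
  obtain f' where f'1: "\<And>t. t \<in> {?c<..<?d} \<Longrightarrow>
        ((\<lambda>t. integral {?c..?d} (\<lambda>s. R s t * \<phi> s)) has_real_derivative f' t) (at t)"
    and f'2: "\<And>t. t \<in> {?c<..<?d} \<Longrightarrow>
       (f' has_real_derivative integral {?c..?d} (\<lambda>s. D2 (D2 R) s t * \<phi> s) - alpha R t * \<phi> t) (at t)"
    using integral_second_derivative[OF cd \<phi>_cont] by blast
  \<comment> \<open>\<phi> vanishes outside the window, whose endpoints lie strictly between 0 and 1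
    as \<open>integral_second_derivative\<close> requires.\<close>
  have sc': "smoothed_cov R K x h t = integral {?c..?d} (\<lambda>s. R s t * \<phi> s)" for t
    unfolding sc by (rule integral_vanishing_outside(1)) (use h \<phi>0 in auto)
  \<comment> \<open>The functional whose squared norm is \<open>V\<close>, evaluated at
    \<open>R02_plus R t\<close>; the norm bound of (C) makes it at most \<open>C0 * sqrt V\<close>,
    uniformly in \<open>t\<close>.\<close>
  define r where "r t = integral {0..1} (\<lambda>s. \<phi> s * R02_plus R t s) - (\<Sum>j<n. w j * R02_plus R t (ts ! j))" for t
  have r_bd: "\<bar>r t\<bar> \<le> C0 * sqrt V" if "t \<in> {0..1}" for t
  proof -
    let ?v = "R02_plus R t"
    have "\<bar>r t\<bar> \<le> sqrt (ip ?v ?v * V)"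
      using R02_functional[OF R02_in[OF that]] real_le_rsqrt[of "\<bar>r t\<bar>"] by (simp add: r_def)
    also have "\<dots> = ip_norm ip ?v * sqrt V" by (simp add: ip_norm_def real_sqrt_mult)
    also have "\<dots> \<le> C0 * sqrt V" using R02_norm[OF that] V_nonneg by (intro mult_right_mono) auto
    finally show ?thesis .
  qed
  have C0: "0 \<le> C0 * sqrt V" using C0_nonneg V_nonneg by simp
  define e' where "e' t = f' t - (\<Sum>j<n. w j * D2 R (ts ! j) t)" for t
  have e_der: "(e has_real_derivative e' t) (at t)" "(e' has_real_derivative r t - alpha R t * \<phi> t) (at t)"
    if t: "t \<in> {?c<..<?d}" and off: "\<And>j. j < n \<Longrightarrow> ts ! j \<noteq> t" for t
  proof -
    have t01: "t \<in> {0<..<1}" using t cd by auto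
    show "(e has_real_derivative e' t) (at t)"
      unfolding e_def [abs_def] e'_def sc'
      by (intro DERIV_diff f'1 t DERIV_sum DERIV_cmult has_derivative_D2(1) ts01 t01 off) auto
    have "integral {0..1} (\<lambda>s. \<phi> s * R02_plus R t s) = integral {?c..?d} (\<lambda>s. \<phi> s * R02_plus R t s)"
      by (rule integral_vanishing_outside(1)) (use h \<phi>0 in auto)
    \<comment> \<open>\<open>R02_plus R t s\<close> and \<open>D2 (D2 R) s t\<close> can differ only
      at \<open>s = t\<close>, a null set here; in the finite sum below that case is excluded by
      \<open>off\<close>.\<close>
    also have "\<dots> = integral {?c..?d} (\<lambda>s. D2 (D2 R) s t * \<phi> s)"
      by (rule integral_spike[of "{t}"]) (use R02_plus_eq[OF _ t01] cd in \<open>auto simp: mult.commute\<close>)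
    finally have "r t - alpha R t * \<phi> t = (integral {?c..?d} (\<lambda>s. D2 (D2 R) s t * \<phi> s) - alpha R t * \<phi> t)
        - (\<Sum>j<n. w j * D2 (D2 R) (ts ! j) t)"
      using R02_plus_eq[OF ts01 t01 off] by (simp add: r_def)
    moreover have "(e' has_real_derivative (integral {?c..?d} (\<lambda>s. D2 (D2 R) s t * \<phi> s) - alpha R t * \<phi> t)
        - (\<Sum>j<n. w j * D2 (D2 R) (ts ! j) t)) (at t)"
      unfolding e'_def [abs_def]
      by (intro DERIV_diff[OF f'2[OF t]] DERIV_sum DERIV_cmult has_derivative_D2(2) ts01 t01 off) auto
    ultimately show "(e' has_real_derivative r t - alpha R t * \<phi> t) (at t)" by (simp only:)
  qed

  \<comment> \<open>Error on single design intervals\<close>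
  let ?\<psi> = "\<lambda>t. alpha R t / (f t)\<^sup>2 * (\<phi> t)\<^sup>2"
  define \<eta> where "\<eta> = D\<^sup>2 * ((2 * M * A * L + M\<^sup>2 * La) * D / h ^ 3 + M * (C0 * sqrt V) / h)
        + 1 / (12 * (real n)\<^sup>2) * (((2 * M * A * L + M\<^sup>2 * La) / cf\<^sup>2 + 2 * A * M\<^sup>2 * Lf / cf ^ 3) * D / h ^ 3)"
  have D0: "0 < D" using cf n by (simp add: D_def)
  have "0 \<le> \<eta>"
    unfolding \<eta>_def using nn cf h D0 C0_nonneg V_nonneg
    by (intro add_nonneg_nonneg mult_nonneg_nonneg divide_nonneg_nonneg) auto
  \<comment> \<open>Clamping to the window: an interval inside it keeps its length, every other
    interval gets a nonnegative weight, and the weights telescope to at most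
    \<open>4 * h\<close>.\<close>
  define \<kappa> where "\<kappa> t = max ?c (min t ?d)" for t
  have term_bd: "\<bar>integral {T i..T (Suc i)} (\<lambda>t. \<phi> t * e t) - 1 / (12 * (real n)\<^sup>2) * integral {T i..T (Suc i)} ?\<psi>\<bar>
      \<le> (\<kappa> (T (Suc i)) - \<kappa> (T i)) * \<eta>" if i: "i < n" for i
  proof (cases "{T i..T (Suc i)} \<inter> {x - h..x + h} = {}")
    case True
    then have "\<phi> t = 0" if "t \<in> {T i..T (Suc i)}" for t using \<phi>0 that by blast
    then have "integral {T i..T (Suc i)} (\<lambda>t. \<phi> t * e t) = 0" "integral {T i..T (Suc i)} ?\<psi> = 0"
      by (auto intro!: integral_unique has_integral_is_0)
    moreover have "\<kappa> (T i) \<le> \<kappa> (T (Suc i))" using T(4)[of i "Suc i"] i by (auto simp: \<kappa>_def)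
    ultimately show ?thesis using \<open>0 \<le> \<eta>\<close> by simp
  next
    case False
    let ?a = "T i" and ?b = "T (Suc i)"
    have ab: "?a < ?b" using T(4)[of i "Suc i"] i by simp
    obtain \<xi> where \<xi>: "\<xi> \<in> {?a..?b}" "f \<xi> * (?b - ?a) = 1 / real n" using T(5)[OF i] by blast
    have ab01: "{?a..?b} \<subseteq> {0..1}" using T(3)[of i] T(3)[of "Suc i"] i by auto
    have "cf * (?b - ?a) \<le> f \<xi> * (?b - ?a)"
      using cf(2)[of \<xi>] \<xi>(1) ab01 ab by (intro mult_right_mono) auto
    then have "?b - ?a \<le> D" using cf(1) \<xi>(2) n by (simp add: D_def field_simps)
    moreover have "D \<le> h" using mesh by (simp add: D_def)
    ultimately have sub: "{?a..?b} \<subseteq> {?c..?d}" and ab_cd: "?c \<le> ?a" "?b \<le> ?d"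
      using False by auto
    \<comment> \<open>\<open>T 0 = 0\<close> lies outside the window, so the interval starts at a
      design point, namely \<open>ts ! (i - 1)\<close>, and \<open>e\<close> vanishes at both
      ends.\<close>
    have "i \<noteq> 0" using ab_cd(1) cd T(1) by (cases i) auto
    then obtain i' where i': "i = Suc i'" using not0_implies_Suc by blast
    have off: "ts ! j \<noteq> t" if "t \<in> {?a<..<?b}" "j < n" for j t
    proof -
      have "T (Suc j) \<le> T i \<or> T (Suc i) \<le> T (Suc j)"
      proof (cases "Suc j \<le> i")
        case True
        then show ?thesis using T(4)[of "Suc j" i] i by (cases "Suc j = i") auto
      next
        case False
        then show ?thesis using T(4)[of "Suc i" "Suc j"] that(2) by (cases "j = i") auto
      qed
      then show ?thesis using tsT[OF that(2)] that(1) by auto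
    qed
    have c01: "{?a..?b} \<subseteq> {0<..<1}" using sub cd by auto
    have "\<bar>integral {?a..?b} (\<lambda>t. \<phi> t * e t) - 1 / (12 * (real n)\<^sup>2) * integral {?a..?b} ?\<psi>\<bar> \<le> (?b - ?a) * \<eta>"
      unfolding \<eta>_def
    proof (rule interval_error_estimate[OF h(1,2) ab \<open>?b - ?a \<le> D\<close> n, where e' = e' and r = r and \<xi> = \<xi>])
      show "continuous_on {?a..?b} e" by (rule continuous_on_subset[OF e_cont ab01])
      show "e ?a = 0" using e0[of i'] tsT[of i'] i i' by simp
      show "e ?b = 0" using e0[of i] tsT[of i] i by simp
      show "continuous_on {?a..?b} (alpha R)" by (rule continuous_on_subset[OF alpha_cont c01])
      show "continuous_on {?a..?b} f" by (rule continuous_on_subset[OF f_cont ab01])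
      show "\<bar>r t\<bar> \<le> C0 * sqrt V" if "t \<in> {?a<..<?b}" for t using r_bd[of t] that ab01 by auto
      show "(e has_real_derivative e' t) (at t)" if "t \<in> {?a<..<?b}" for t
        by (rule e_der(1)) (use that ab_cd off in auto)
      show "(e' has_real_derivative r t - alpha R t * \<phi> t) (at t)" if "t \<in> {?a<..<?b}" for t
        by (rule e_der(2)) (use that ab_cd off in auto)
      show "\<bar>\<phi> t\<bar> \<le> M / h" if "t \<in> {?a..?b}" for t using \<phi>M that sub by blast
      show "\<bar>\<phi> s - \<phi> t\<bar> \<le> L / h\<^sup>2 * \<bar>s - t\<bar>" if "s \<in> {?a..?b}" "t \<in> {?a..?b}" for s t
        using \<phi>L that sub by blast
      show "\<bar>alpha R t\<bar> \<le> A" if "t \<in> {?a..?b}" for t using \<alpha>(1) that c01 by blast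
      show "\<bar>alpha R s - alpha R t\<bar> \<le> La * \<bar>s - t\<bar>" if "s \<in> {?a..?b}" "t \<in> {?a..?b}" for s t
        using \<alpha>(2) that c01 by blast
      show "cf \<le> f t" if "t \<in> {?a..?b}" for t using cf(2) that ab01 by blast
      show "\<bar>f s - f t\<bar> \<le> Lf * \<bar>s - t\<bar>" if "s \<in> {?a..?b}" "t \<in> {?a..?b}" for s t
        using Lf that ab01 by blast
    qed (use \<xi> nn C0 cf(1) \<phi>_cont in auto)
    moreover have "\<kappa> ?a = ?a" "\<kappa> ?b = ?b" using ab_cd ab by (auto simp: \<kappa>_def)
    ultimately show ?thesis by simp
  qed

  \<comment> \<open>Summation over the design intervals\<close>
  have \<psi>_cont: "continuous_on {x - h..x + h} ?\<psi>"
  proof (intro continuous_intros \<phi>_cont)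
    show "continuous_on {x - h..x + h} (alpha R)" by (rule continuous_on_subset[OF alpha_cont]) (use h in auto)
    show "continuous_on {x - h..x + h} f" by (rule continuous_on_subset[OF f_cont]) (use h in auto)
    have "0 < f t" if "t \<in> {x - h..x + h}" for t using cf(1) cf(2)[of t] h that by auto
    then show "\<forall>t\<in>{x - h..x + h}. (f t)\<^sup>2 \<noteq> 0" by force
  qed
  have "norm (integral {x - h..x + h} ?\<psi>) \<le> A * (1 / cf\<^sup>2) * (M / h)\<^sup>2 * ((x + h) - (x - h))"
  proof (rule integral_bound[OF _ \<psi>_cont])
    fix t assume t: "t \<in> {x - h..x + h}"
    have "norm (?\<psi> t) = \<bar>alpha R t\<bar> * (1 / (f t)\<^sup>2) * \<bar>\<phi> t\<bar>\<^sup>2" by (simp add: abs_mult)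
    also have "\<dots> \<le> A * (1 / cf\<^sup>2) * (M / h)\<^sup>2"
    proof (intro mult_mono power_mono divide_left_mono)
      show "\<bar>alpha R t\<bar> \<le> A" using \<alpha>(1)[of t] t h by auto
      have ft: "cf \<le> f t" using cf(2)[of t] t h by auto
      then show "cf \<le> f t" .
      show "0 < (f t)\<^sup>2 * cf\<^sup>2" using ft cf(1) by simp
      show "\<bar>\<phi> t\<bar> \<le> M / h" using \<phi>M[of t] t h by auto
    qed (use nn cf(1) in auto)
    finally show "norm (?\<psi> t) \<le> A * (1 / cf\<^sup>2) * (M / h)\<^sup>2" .
  qed (use h in auto)
  also have "\<dots> = 2 * A * M\<^sup>2 / cf\<^sup>2 / h" using h cf by (simp add: field_simps power2_eq_square)
  finally show "\<bar>integral {x - h..x + h} (\<lambda>t. alpha R t / (f t)\<^sup>2 * (phi K x h t)\<^sup>2)\<bar> \<le> 2 * A * M\<^sup>2 / cf\<^sup>2 / h"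
    by (simp add: \<phi>_def)
  have \<psi>_int: "?\<psi> integrable_on {0..1}" and \<psi>_eq: "integral {0..1} ?\<psi> = integral {x - h..x + h} ?\<psi>"
    using integral_vanishing_outside[of "x - h" "x + h" 0 1 ?\<psi>] integrable_continuous_real[OF \<psi>_cont] h \<phi>0 by auto
  have \<phi>e_int: "(\<lambda>t. \<phi> t * e t) integrable_on {0..1}"
    by (intro integrable_continuous_real continuous_intros \<phi>_cont e_cont)
  have part: "integral {0..1} g = (\<Sum>i<n. integral {T i..T (Suc i)} g)"
    if "g integrable_on {0..1}" for g :: "real \<Rightarrow> real"
    using integral_partition[of n T g] T(1,2) T(4)[OF lessI] that by (auto simp: less_imp_le)
  have "\<bar>V - 1 / (12 * (real n)\<^sup>2) * integral {x - h..x + h} ?\<psi>\<bar>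
      = \<bar>\<Sum>i<n. integral {T i..T (Suc i)} (\<lambda>t. \<phi> t * e t) - 1 / (12 * (real n)\<^sup>2) * integral {T i..T (Suc i)} ?\<psi>\<bar>"
    unfolding V_int \<psi>_eq[symmetric] part[OF \<phi>e_int] part[OF \<psi>_int] by (simp add: sum_subtractf sum_distrib_left)
  also have "\<dots> \<le> (\<Sum>i<n. (\<kappa> (T (Suc i)) - \<kappa> (T i)) * \<eta>)"
    by (rule order_trans[OF sum_abs sum_mono]) (use term_bd in auto)
  also have "\<dots> = (\<kappa> (T n) - \<kappa> (T 0)) * \<eta>"
    unfolding sum_distrib_right[symmetric] sum_lessThan_telescope[of "\<lambda>i. \<kappa> (T i)"] ..
  also have "\<dots> \<le> 4 * h * \<eta>"
    using \<open>0 \<le> \<eta>\<close> h by (intro mult_right_mono) (auto simp: \<kappa>_def)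
  finally show "\<bar>V - 1 / (12 * (real n)\<^sup>2) * integral {x - h..x + h} (\<lambda>t. alpha R t / (f t)\<^sup>2 * (phi K x h t)\<^sup>2)\<bar>
      \<le> 4 * h * ((1 / (cf * real n))\<^sup>2
            * ((2 * M * A * L + M\<^sup>2 * La) * (1 / (cf * real n)) / h ^ 3 + M * (C0 * sqrt V) / h)
          + 1 / (12 * (real n)\<^sup>2) * (((2 * M * A * L + M\<^sup>2 * La) / cf\<^sup>2 + 2 * A * M\<^sup>2 * Lf / cf ^ 3)
            * (1 / (cf * real n)) / h ^ 3))"
    unfolding \<eta>_def D_def \<phi>_def .
qed


section \<open>Removing the root of the error from its own bound\<close>

text \<open>In the scaled unknown \<open>y = sqrt V * (n * h)\<close> the hypotheses give
  \<open>y^2 \<le> E0 + E1 + E2 * y\<close>, which bounds \<open>y\<close> by a constant. So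
  \<open>sqrt V\<close> is of order \<open>1 / (n * h)\<close>, and the term
  \<open>E2 * sqrt V / n^2\<close> is of order \<open>1 / (n^3 * h)\<close>, within the claimed
  error since \<open>h < 1\<close>.\<close>

lemma error_bootstrap:
  fixes n :: nat and h V J E0 E1 E2 :: real
  assumes V: "0 \<le> V" and h: "0 < h" "h < 1" and nh: "1 \<le> real n * h"
    and E: "0 \<le> E0" "0 \<le> E1" "0 \<le> E2"
    and J: "\<bar>J\<bar> \<le> E0 / ((real n)\<^sup>2 * h)"
    and err: "\<bar>V - J\<bar> \<le> E1 / (real n ^ 3 * h\<^sup>2) + E2 * sqrt V / (real n)\<^sup>2"
  shows "\<bar>V - J\<bar> \<le> (E1 + E2 * (E0 + E1 + E2 + 1)) / (real n ^ 3 * h\<^sup>2)"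
proof -
  define N where "N = real n"
  have N: "1 \<le> N" and nh': "1 \<le> N * h"
  proof -
    show "1 \<le> N * h" using nh by (simp add: N_def)
    have "n \<noteq> 0" using nh by (cases n) auto
    then show "1 \<le> N" by (simp add: N_def)
  qed
  define y where "y = sqrt V * (N * h)"
  have y0: "0 \<le> y" using V h N by (simp add: y_def)
  have sV: "sqrt V = y / (N * h)" using h N by (simp add: y_def)
  have "V \<le> E0 / (N\<^sup>2 * h) + E1 / (N ^ 3 * h\<^sup>2) + E2 * sqrt V / N\<^sup>2"
    using J err unfolding N_def by linarith
  then have "V * (N * h)\<^sup>2 \<le> (E0 / (N\<^sup>2 * h) + E1 / (N ^ 3 * h\<^sup>2) + E2 * sqrt V / N\<^sup>2) * (N * h)\<^sup>2"
    by (rule mult_right_mono) simp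
  moreover have "y\<^sup>2 = V * (N * h)\<^sup>2" using V by (simp add: y_def power_mult_distrib)
  moreover have "(E0 / (N\<^sup>2 * h) + E1 / (N ^ 3 * h\<^sup>2) + E2 * sqrt V / N\<^sup>2) * (N * h)\<^sup>2
      = E0 * h + E1 * (1 / N) + E2 * y * (h * (1 / N))"
    unfolding sV using h N by (simp add: field_simps power2_eq_square power3_eq_cube)
  ultimately have "y\<^sup>2 \<le> E0 * h + E1 * (1 / N) + E2 * y * (h * (1 / N))" by simp
  also have "\<dots> \<le> E0 * 1 + E1 * 1 + E2 * y * (1 * 1)"
    using E y0 h N by (intro add_mono mult_left_mono mult_mono) auto
  finally have quad: "y\<^sup>2 \<le> E0 + E1 + E2 * y" by simp
  \<comment> \<open>For \<open>y > 1\<close> the constant part \<open>E0 + E1\<close> is at most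
    \<open>(E0 + E1) * y\<close>, and the quadratic inequality can be divided by \<open>y\<close>;
    the summand 1 covers \<open>y \<le> 1\<close>.\<close>
  have y_le: "y \<le> E0 + E1 + E2 + 1"
  proof (cases "y \<le> 1")
    case True
    then show ?thesis using E by linarith
  next
    case False
    have "(E0 + E1) * 1 \<le> (E0 + E1) * y" using False E by (intro mult_left_mono) auto
    then have "y * y \<le> (E0 + E1 + E2) * y" using quad by (simp add: power2_eq_square algebra_simps)
    then have "y \<le> E0 + E1 + E2" using False by simp
    then show ?thesis by simp
  qed
  have "E2 * sqrt V / N\<^sup>2 = E2 * y * h / (N ^ 3 * h\<^sup>2)"
    unfolding sV using h N by (simp add: field_simps power2_eq_square power3_eq_cube)
  also have "\<dots> \<le> E2 * (E0 + E1 + E2 + 1) * 1 / (N ^ 3 * h\<^sup>2)"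
    using E y_le y0 h N by (intro divide_right_mono mult_mono) auto
  finally show ?thesis using err unfolding N_def by (simp add: add_divide_distrib)
qed

text \<open>The range from -2 to 2 is that of the scaled argument \<open>(x - t) / h\<close> when
  \<open>t\<close> runs over the window of half-width \<open>2 * h\<close>. The bounds extend beyond
  the support because \<open>K\<close> is of class C1 on the whole line.\<close>

lemma smoothing_kernel_bounds:
  assumes "smoothing_kernel K"
  obtains M L where "0 \<le> M" "0 \<le> L" "continuous_on UNIV K" "\<And>u. 1 < \<bar>u\<bar> \<Longrightarrow> K u = 0"
    "\<And>u. u \<in> {-2..2} \<Longrightarrow> \<bar>K u\<bar> \<le> M"
    "\<And>u v. u \<in> {-2..2} \<Longrightarrow> v \<in> {-2..2} \<Longrightarrow> \<bar>K u - K v\<bar> \<le> L * \<bar>u - v\<bar>"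
proof -
  obtain K' where K': "\<And>u. (K has_real_derivative K' u) (at u)" and K'c: "continuous_on UNIV K'"
    using assms unfolding smoothing_kernel_def C1_differentiable_on_def has_real_derivative_iff_has_vector_derivative
    by auto
  have Kc: "continuous_on UNIV K"
    using K' by (intro DERIV_continuous_on) auto
  have K0: "K u = 0" if "1 < \<bar>u\<bar>" for u
  proof (rule ccontr)
    assume "K u \<noteq> 0"
    then have "u \<in> closure {u. K u \<noteq> 0}" by (intro subsetD[OF closure_subset]) simp
    moreover have "closure {u. K u \<noteq> 0} = {-1..1}" using assms by (simp add: smoothing_kernel_def)
    ultimately show False using that by auto
  qed
  have bdd: "\<exists>B. \<forall>u\<in>{-2..2}. \<bar>g u\<bar> \<le> B" if "continuous_on UNIV g" for g :: "real \<Rightarrow> real"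
    using compact_imp_bounded[OF compact_continuous_image[OF continuous_on_subset[OF that], of "{-2..2}"]]
    unfolding bounded_iff by auto
  obtain M where M: "\<And>u. u \<in> {-2..2} \<Longrightarrow> \<bar>K u\<bar> \<le> M" using bdd[OF Kc] by blast
  obtain L where L: "\<And>u. u \<in> {-2..2} \<Longrightarrow> \<bar>K' u\<bar> \<le> L" using bdd[OF K'c] by blast
  have *: "\<bar>K v - K u\<bar> \<le> L * (v - u)" if uv: "u \<in> {-2..2}" "v \<in> {-2..2}" "u \<le> v" for u v
    by (rule lipschitz_except_point[OF continuous_on_subset[OF Kc] uv(3) K' L]) (use uv in auto)
  have "\<bar>K u - K v\<bar> \<le> L * \<bar>u - v\<bar>" if "u \<in> {-2..2}" "v \<in> {-2..2}" for u v
    using *[OF that] *[OF that(2,1)] by (cases "u \<le> v") (auto simp: abs_minus_commute)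
  moreover have "0 \<le> M" "0 \<le> L" using M[of 0] L[of 0] by auto
  ultimately show thesis using that Kc K0 M by blast
qed

theorem proposition8:
  fixes g f K :: "real \<Rightarrow> real"
    and R :: "real \<Rightarrow> real \<Rightarrow> real"
    and M0 :: "'b measure" and e :: "real \<Rightarrow> 'b \<Rightarrow> real"
    and M :: "nat \<Rightarrow> 'a measure" and eps :: "nat \<Rightarrow> nat \<Rightarrow> real \<Rightarrow> 'a \<Rightarrow> real"
    and h :: "nat \<Rightarrow> real" and x :: real
  assumes "C2_on {0..1} g"
    and "centered_second_order_process M0 e"
    and "has_autocovariance M0 e R"
    and "nonsingular_kernel R"
    and "\<And>m. m \<ge> 1 \<Longrightarrow> iid_copies (M m) m (eps m) M0 e"
    and "smoothing_kernel K"
    and "design_density f"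
    and "assumption_A R" and "assumption_B R" and "assumption_C R" and "assumption_D K"
    and "\<And>n. n \<ge> 1 \<Longrightarrow> 0 < h n \<and> h n < 1"
    and "h \<longlonglongrightarrow> 0"
    and "filterlim (\<lambda>n. real n * h n) at_top sequentially"
    and "x \<in> {0<..<1}"
  shows "\<exists>C N. \<forall>n\<ge>N. \<forall>m\<ge>1.
    \<bar>prob_space.variance (M m) (g_pro R K (h n) (design f n) g (eps m) m x)
      - (sigma_sq R K x (h n) / real m
         - 1 / (12 * real m * real n ^ 2)
           * integral {x - h n..x + h n} (\<lambda>t. alpha R t / (f t)\<^sup>2 * (phi K x (h n) t)\<^sup>2))\<bar>
    \<le> C * (1 / (real m * real n ^ 3 * (h n)\<^sup>2))"
proof -
  obtain La where La: "La-lipschitz_on {0<..<1} (alpha R)" using assms(9) by (auto simp: assumption_B_def)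
  have \<alpha>L: "\<bar>alpha R s - alpha R t\<bar> \<le> La * \<bar>s - t\<bar>" if "s \<in> {0<..<1}" "t \<in> {0<..<1}" for s t
    using lipschitz_onD[OF La that] by (simp add: dist_real_def)
  obtain A where \<alpha>A: "\<And>t. t \<in> {0<..<1} \<Longrightarrow> \<bar>alpha R t\<bar> \<le> A"
  proof -
    obtain c C where "0 < c" "\<forall>t\<in>{0<..<1}. c \<le> alpha R t" "\<forall>t\<in>{0<..<1}. alpha R t \<le> C"
      using assms(9) by (auto simp: assumption_B_def)
    then show thesis by (intro that[of C]) force
  qed
  obtain H ip C0 where rk: "is_RKHS {0..1} R H ip" "\<And>t. t \<in> {0..1} \<Longrightarrow> R02_plus R t \<in> H"
    "\<And>t. t \<in> {0..1} \<Longrightarrow> ip_norm ip (R02_plus R t) \<le> C0"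
    using assms(10) unfolding assumption_C_def by blast
  interpret rkhs_covariance R H ip C0
  proof
    show "R s t = R t s" if "s \<in> {0..1}" "t \<in> {0..1}" for s t
      using assms(3) that by (simp add: has_autocovariance_def mult.commute)
  qed (use rk assms(8) lipschitz_on_continuous_on[OF La] in auto)
  obtain cf Lf where cf: "0 < cf" "continuous_on {0..1} f" "\<And>t. t \<in> {0..1} \<Longrightarrow> cf \<le> f t"
    "\<And>s t. s \<in> {0..1} \<Longrightarrow> t \<in> {0..1} \<Longrightarrow> \<bar>f s - f t\<bar> \<le> Lf * \<bar>s - t\<bar>" "0 \<le> Lf"
    using design_density_bounds[OF assms(7)] by blast
  obtain MK L where K: "0 \<le> MK" "0 \<le> L" "continuous_on UNIV K" "\<And>u. 1 < \<bar>u\<bar> \<Longrightarrow> K u = 0"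
    "\<And>u. u \<in> {-2..2} \<Longrightarrow> \<bar>K u\<bar> \<le> MK"
    "\<And>u v. u \<in> {-2..2} \<Longrightarrow> v \<in> {-2..2} \<Longrightarrow> \<bar>K u - K v\<bar> \<le> L * \<bar>u - v\<bar>"
    using smoothing_kernel_bounds[OF assms(6)] by blast
  have A0: "0 \<le> A" using \<alpha>A[of "1/2"] by auto
  have La0: "0 \<le> La" by (rule lipschitz_on_nonneg[OF La])
  \<comment> \<open>\<open>G1\<close> measures the variation of \<open>\<alpha> \<phi>^2\<close>,
    and \<open>G2\<close> adds that of \<open>1 / f^2\<close>. \<open>E1\<close> and
    \<open>E2\<close> are the coefficients left after multiplying out the factor
    \<open>4 * h\<close> in the error estimate; \<open>E0\<close> bounds the main term, including
    its factor \<open>1 / 12\<close>.\<close>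
  define G1 where "G1 = 2 * MK * A * L + MK\<^sup>2 * La"
  define G2 where "G2 = G1 / cf\<^sup>2 + 2 * A * MK\<^sup>2 * Lf / cf ^ 3"
  define E0 where "E0 = 2 * A * MK\<^sup>2 / cf\<^sup>2 / 12"
  define E1 where "E1 = 4 * G1 / cf ^ 3 + G2 / (3 * cf)"
  define E2 where "E2 = 4 * MK * C0 / cf\<^sup>2"
  have G: "0 \<le> G1" "0 \<le> G2" using K(1,2) A0 La0 cf(1,5) by (auto simp: G1_def G2_def)
  have E: "0 \<le> E0" "0 \<le> E1" "0 \<le> E2"
    using K(1,2) A0 La0 cf(1,5) G C0_nonneg by (auto simp: E0_def E1_def E2_def)

  \<comment> \<open>The second condition puts the window inside the open unit interval. The third
    ensures both that the mesh \<open>1 / (cf * n)\<close> is at most \<open>h n\<close> and that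
    \<open>n * h n\<close> is at least 1, as the bootstrap requires.\<close>
  have "\<forall>\<^sub>F n in sequentially. 1 \<le> n \<and> h n < min x (1 - x) / 2 \<and> max 1 (1 / cf) \<le> real n * h n"
  proof (intro eventually_conj)
    show "\<forall>\<^sub>F n in sequentially. h n < min x (1 - x) / 2"
      by (rule order_tendstoD(2)[OF assms(13)]) (use assms(15) in auto)
    show "\<forall>\<^sub>F n in sequentially. max 1 (1 / cf) \<le> real n * h n"
      using assms(14) unfolding filterlim_at_top by blast
  qed (rule eventually_ge_at_top)
  then obtain N where N: "\<And>n. n \<ge> N \<Longrightarrow> 1 \<le> n \<and> h n < min x (1 - x) / 2 \<and> max 1 (1 / cf) \<le> real n * h n"
    unfolding eventually_sequentially by blast
  show ?thesis
  proof (intro exI allI impI)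
    fix n m :: nat assume n: "N \<le> n" and m: "1 \<le> m"
    have hn: "0 < h n" "h n < 1" "0 < x - 2 * h n" "x + 2 * h n < 1" and n0: "0 < n"
      and nh: "1 \<le> real n * h n" "1 / cf \<le> real n * h n"
      using N[OF n] assms(12)[of n] by auto
    have D: "1 / (cf * real n) \<le> h n" using nh(2) n0 cf(1) by (simp add: field_simps)
    define w where "w = vec_index (projection_weights R K x (h n) (design f n))"
    define Q where "Q = (\<Sum>i<n. \<Sum>j<n. w i * w j * R (design f n ! i) (design f n ! j))"
    define V where "V = sigma_sq R K x (h n) - Q"
    define I where "I = integral {x - h n..x + h n} (\<lambda>t. alpha R t / (f t)\<^sup>2 * (phi K x (h n) t)\<^sup>2)"
    note est = projection_error_estimate[OF assms(4,7) n0 hn K(3,4,5,6) \<alpha>A \<alpha>L cf(1,3,2,4) K(1,2) A0 La0 cf(5) D,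
        folded w_def, folded Q_def, folded V_def I_def G1_def, folded G2_def]
    have V0: "0 \<le> V" by (rule est(1))
    have "\<bar>1 / (12 * (real n)\<^sup>2) * I\<bar> \<le> 1 / (12 * (real n)\<^sup>2) * (2 * A * MK\<^sup>2 / cf\<^sup>2 / h n)"
      unfolding abs_mult using est(3) by (intro mult_mono) auto
    then have J: "\<bar>1 / (12 * (real n)\<^sup>2) * I\<bar> \<le> E0 / ((real n)\<^sup>2 * h n)"
      by (simp add: E0_def mult_ac)
    have "\<bar>V - 1 / (12 * (real n)\<^sup>2) * I\<bar> \<le> 4 * h n * ((1 / (cf * real n))\<^sup>2
            * (G1 * (1 / (cf * real n)) / h n ^ 3 + MK * (C0 * sqrt V) / h n)
          + 1 / (12 * (real n)\<^sup>2) * (G2 * (1 / (cf * real n)) / h n ^ 3))"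
      by (rule est(2))
    also have "\<dots> = E1 / (real n ^ 3 * (h n)\<^sup>2) + E2 * sqrt V / (real n)\<^sup>2"
      using hn(1) n0 cf(1) by (simp add: E1_def E2_def field_simps power2_eq_square power3_eq_cube)
    finally have err: "\<bar>V - 1 / (12 * (real n)\<^sup>2) * I\<bar> \<le> (E1 + E2 * (E0 + E1 + E2 + 1)) / (real n ^ 3 * (h n)\<^sup>2)"
      by (rule error_bootstrap[OF V0 hn(1,2) nh(1) E J])
    have len: "length (design f n) = n" by (simp add: design_def)
    have "set (design f n) \<subseteq> {0..1}"
      using design_point_properties(3)[OF assms(7) n0] by (auto simp: design_def simp del: upt_Suc)
    from variance_g_pro[OF assms(2,3) assms(5)[OF m] m this]
    have var: "prob_space.variance (M m) (g_pro R K (h n) (design f n) g (eps m) m x) = Q / real m"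
      by (simp only: len w_def Q_def)
    \<comment> \<open>The estimate for \<open>V\<close> does not involve \<open>m\<close>; dividing
      it by \<open>m\<close> yields the claim with a constant uniform in \<open>m\<close>.\<close>
    have "Q / real m - (sigma_sq R K x (h n) / real m - 1 / (12 * real m * (real n)\<^sup>2) * I)
        = - ((V - 1 / (12 * (real n)\<^sup>2) * I) / real m)"
      using m n0 by (simp add: V_def field_simps)
    then have "\<bar>Q / real m - (sigma_sq R K x (h n) / real m - 1 / (12 * real m * (real n)\<^sup>2) * I)\<bar>
        = \<bar>V - 1 / (12 * (real n)\<^sup>2) * I\<bar> / real m"
      by (simp only: abs_minus_cancel abs_divide abs_of_nat)
    also have "\<dots> \<le> (E1 + E2 * (E0 + E1 + E2 + 1)) / (real n ^ 3 * (h n)\<^sup>2) / real m"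
      by (rule divide_right_mono[OF err]) simp
    also have "\<dots> = (E1 + E2 * (E0 + E1 + E2 + 1)) * (1 / (real m * real n ^ 3 * (h n)\<^sup>2))"
      by (simp add: mult_ac)
    finally show "\<bar>prob_space.variance (M m) (g_pro R K (h n) (design f n) g (eps m) m x)
      - (sigma_sq R K x (h n) / real m
         - 1 / (12 * real m * real n ^ 2)
           * integral {x - h n..x + h n} (\<lambda>t. alpha R t / (f t)\<^sup>2 * (phi K x (h n) t)\<^sup>2))\<bar>
      \<le> (E1 + E2 * (E0 + E1 + E2 + 1)) * (1 / (real m * real n ^ 3 * (h n)\<^sup>2))"
      unfolding var I_def .
  qed
qed

end
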